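(* Let $\mathcal{M}=\{M^{(\lambda)}:\lambda>0\}$ and $\mathcal{N}=\{N^{(\lambda)}:\lambda>0\}$ be two quasianalytic weight matrices and put $n^{(\lambda)}_j:=N^{(\lambda)}_j/j!$. (i) (Roumieu case) Assume that for every $\lambda>0$ there exist $\kappa>0$ and $C,h>0$ such that $(n^{(\lambda)}_j)^2\le Ch^jn^{(\kappa)}_j$ for all $j\in\mathbb{N}$, and that $\mathcal{O}^0\subsetneq\mathcal{E}^0_{\{\mathcal{N}\}}$. Then $\mathcal{F}_{\{\mathcal{N}\}}\setminus j^\infty(\mathcal{E}^0_{\{\mathcal{M}\}})$ is $\mathfrak{c}$-algebrable in $\mathcal{F}_{\{\mathcal{N}\}}$ endowed with the pointwise product $\odot$ (hence $\mathcal{F}_{\{\mathcal{N}\}}\setminus j^\infty(\mathcal{E}^0_{(\mathcal{M})})$ too). (ii) (Beurling case) Assume that for every $\lambda>0$ there exist $\kappa>0$ and $C,h>0$ such that $(n^{(\kappa)}_j)^2\le Ch^jn^{(\lambda)}_j$ for all $j\in\mathbb{N}$, and that $\mathcal{O}^0\subsetneq\mathcal{E}^0_{(\mathcal{N})}$. Then $\mathcal{F}_{(\mathcal{N})}\setminus j^\infty(\mathcal{E}^0_{\{\mathcal{M}\}})$ is $\mathfrak{c}$-algebrable in $\mathcal{F}_{(\mathcal{N})}$ endowed with the pointwise product $\odot$ (hence $\mathcal{F}_{(\mathcal{N})}\setminus j^\infty(\mathcal{E}^0_{(\mathcal{M})})$ too).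
   Context: $\mathbb{N}=\{0,1,2,\dots\}$; $\mathfrak{c}$ is the cardinality of the continuum. For a sequence $M=(M_j)_{j\in\mathbb{N}}$ of positive reals put $m_j:=M_j/j!$. $M$ is a weight sequence if (I) $1=M_0\le M_1$; (II) $M$ is log-convex, i.e. $M_j^2\le M_{j-1}M_{j+1}$ for all $j\ge1$; (III) $\liminf_{j\to\infty}(m_j)^{1/j}>0$. $M$ is quasianalytic if $\sum_{j\ge1}M_{j-1}/M_j=+\infty$. A weight matrix is a family $\mathcal{M}=\{M^{(\lambda)}:\lambda>0\}$ of weight sequences indexed by the positive reals with $M^{(\lambda)}_j\le M^{(\kappa)}_j$ for all $j$ whenever $0<\lambda\le\kappa$; it is quasianalytic if every $M^{(\lambda)}$ is quasianalytic. Write $m^{(\lambda)}_j:=M^{(\lambda)}_j/j!$. For $U\subseteq\mathbb{R}$ nonempty open, $\mathcal{E}_{\{\mathcal{M}\}}(U)$, resp. $\mathcal{E}_{(\mathcal{M})}(U)$, is the set of complex-valued smooth $f$ on $U$ such that for every compact $K\subseteq U$ there exist $\lambda>0$ and $h>0$, resp. for every compact $K\subseteq U$, all $\lambda>0$ and all $h>0$, $\sup_{j\in\mathbb{N},x\in K}\frac{|f^{(j)}(x)|}{h^jM^{(\lambda)}_j}<+\infty$. $\mathcal{E}^0_{\{\mathcal{M}\}}$, $\mathcal{E}^0_{(\mathcal{M})}$ are the corresponding spaces of germs at $0$, i.e. $\varinjlim_k$ of the spaces on $(-\frac1k,\frac1k)$. $\mathcal{O}^0$ is the space of germs at $0$ of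 real analytic functions. $\mathcal{F}_{\{\mathcal{M}\}}$, resp. $\mathcal{F}_{(\mathcal{M})}$, is the space of formal power series $\mathbf{F}=\sum_{j\ge0}F_jx^j$ with complex coefficients such that for some $\lambda>0$ and some $h>0$, resp. for all $\lambda>0$ and all $h>0$, $\sup_{j}\frac{|F_j|}{h^jm^{(\lambda)}_j}<+\infty$. The Borel map is $j^\infty(f)=\sum_{j\ge0}\frac{f^{(j)}(0)}{j!}x^j$. The pointwise (Hadamard) product is $\mathbf{F}\odot\mathbf{G}=\sum_{j\ge0}F_jG_jx^j$; under the stated growth assumptions on $\mathcal{N}$ the space $\mathcal{F}_{\{\mathcal{N}\}}$, resp. $\mathcal{F}_{(\mathcal{N})}$, is closed under $\odot$. A subset $\mathcal{B}$ of an algebra $\mathcal{A}$ is $\kappa$-algebrable if there is a $\kappa$-generated subalgebra $\mathcal{C}$ of $\mathcal{A}$ (not required to contain a unit) with $\mathcal{C}\subseteq\mathcal{B}\cup\{0\}$; $\kappa$-generated means that $\mathcal{C}$ has a minimal system of generators of cardinality $\kappa$. *)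

theory Defs
  imports "HOL-Analysis.Analysis" "HOL-Computational_Algebra.Formal_Power_Series"
begin

section \<open>Weight sequences and weight matrices\<close>

definition weight_sequence :: "(nat \<Rightarrow> real) \<Rightarrow> bool" where
  "weight_sequence M \<longleftrightarrow>
     (\<forall>j. 0 < M j) \<and>
     M 0 = 1 \<and> 1 \<le> M 1 \<and>
     (\<forall>j\<ge>1. (M j)\<^sup>2 \<le> M (j - 1) * M (j + 1)) \<and>
     liminf (\<lambda>j. ereal (root j (M j / fact j))) > 0"

definition quasianalytic :: "(nat \<Rightarrow> real) \<Rightarrow> bool" where
  "quasianalytic M \<longleftrightarrow> filterlim (\<lambda>n. \<Sum>j=1..n. M (j - 1) / M j) at_top sequentially"

text \<open>A family indexed by the positive reals is a function on \<open>real\<close> whose values at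
  nonpositive arguments are irrelevant.\<close>

definition weight_matrix :: "(real \<Rightarrow> nat \<Rightarrow> real) \<Rightarrow> bool" where
  "weight_matrix \<M> \<longleftrightarrow>
     (\<forall>\<mu>>0. weight_sequence (\<M> \<mu>)) \<and>
     (\<forall>\<mu> \<kappa>. 0 < \<mu> \<longrightarrow> \<mu> \<le> \<kappa> \<longrightarrow> (\<forall>j. \<M> \<mu> j \<le> \<M> \<kappa> j))"

definition quasianalytic_matrix :: "(real \<Rightarrow> nat \<Rightarrow> real) \<Rightarrow> bool" where
  "quasianalytic_matrix \<M> \<longleftrightarrow> (\<forall>\<mu>>0. quasianalytic (\<M> \<mu>))"

section \<open>Ultradifferentiable functions\<close>

definition nth_deriv :: "nat \<Rightarrow> (real \<Rightarrow> complex) \<Rightarrow> real \<Rightarrow> complex" where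
  "nth_deriv j f = ((\<lambda>g x. vector_derivative g (at x)) ^^ j) f"

text \<open>In the spaces of functions on an open set \<open>U\<close> below, functions are total;
  membership only depends on the restriction to \<open>U\<close>.\<close>

definition smooth_on :: "real set \<Rightarrow> (real \<Rightarrow> complex) \<Rightarrow> bool" where
  "smooth_on U f \<longleftrightarrow> (\<forall>j. \<forall>x\<in>U. nth_deriv j f differentiable (at x))"

definition derivs_bounded ::
    "real set \<Rightarrow> real \<Rightarrow> (nat \<Rightarrow> real) \<Rightarrow> (real \<Rightarrow> complex) \<Rightarrow> bool" where
  "derivs_bounded K h M f \<longleftrightarrow>
     bdd_above ((\<lambda>(j, x). norm (nth_deriv j f x) / (h ^ j * M j)) ` (UNIV \<times> K))"

definition E_roumieu :: "(real \<Rightarrow> nat \<Rightarrow> real) \<Rightarrow> real set \<Rightarrow> (real \<Rightarrow> complex) set" where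
  "E_roumieu \<M> U = {f. smooth_on U f \<and>
     (\<forall>K. compact K \<and> K \<subseteq> U \<longrightarrow> (\<exists>\<mu>>0. \<exists>h>0. derivs_bounded K h (\<M> \<mu>) f))}"

definition E_beurling :: "(real \<Rightarrow> nat \<Rightarrow> real) \<Rightarrow> real set \<Rightarrow> (real \<Rightarrow> complex) set" where
  "E_beurling \<M> U = {f. smooth_on U f \<and>
     (\<forall>K. compact K \<and> K \<subseteq> U \<longrightarrow> (\<forall>\<mu>>0. \<forall>h>0. derivs_bounded K h (\<M> \<mu>) f))}"

definition real_analytic :: "real set \<Rightarrow> (real \<Rightarrow> complex) set" where
  "real_analytic U = {f. \<forall>x\<in>U. \<exists>a. \<exists>r>0. \<forall>y. \<bar>y - x\<bar> < r \<longrightarrow>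
     (\<lambda>n. a n * complex_of_real (y - x) ^ n) sums f y}"

section \<open>Germs at the origin\<close>

definition germ0 :: "(real \<Rightarrow> complex) \<Rightarrow> (real \<Rightarrow> complex) set" where
  "germ0 f = {g. \<forall>\<^sub>F x in nhds 0. g x = f x}"

definition germs0 ::
    "(real set \<Rightarrow> (real \<Rightarrow> complex) set) \<Rightarrow> (real \<Rightarrow> complex) set set" where
  "germs0 \<E> = (\<Union>k\<in>{1::nat..}. germ0 ` \<E> {- 1 / real k<..<1 / real k})"

definition borel_fun :: "(real \<Rightarrow> complex) \<Rightarrow> complex fps" where
  "borel_fun f = Abs_fps (\<lambda>j. nth_deriv j f 0 / fact j)"

definition borel_map :: "(real \<Rightarrow> complex) set \<Rightarrow> complex fps" where
  "borel_map G = the_elem (borel_fun ` G)"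

lemma nth_deriv_cong_ev:
  assumes "\<forall>\<^sub>F x in nhds a. g x = f x"
  shows "\<forall>\<^sub>F x in nhds a. nth_deriv j g x = nth_deriv j f x"
proof (induction j)
  case 0
  then show ?case using assms by (simp add: nth_deriv_def)
next
  case (Suc j)
  from Suc have "\<forall>\<^sub>F y in nhds a. \<forall>\<^sub>F x in nhds y. nth_deriv j g x = nth_deriv j f x"
    by (simp add: eventually_eventually)
  then show ?case
  proof (rule eventually_mono)
    fix y assume *: "\<forall>\<^sub>F x in nhds y. nth_deriv j g x = nth_deriv j f x"
    have "vector_derivative (nth_deriv j g) (at y) = vector_derivative (nth_deriv j f) (at y)"
      by (rule vector_derivative_cong_eq) (use * in auto)
    then show "nth_deriv (Suc j) g y = nth_deriv (Suc j) f y"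
      by (simp add: nth_deriv_def)
  qed
qed

lemma borel_map_germ0: "borel_map (germ0 f) = borel_fun f"
proof -
  have "borel_fun g = borel_fun f" if "g \<in> germ0 f" for g
    using eventually_nhds_x_imp_x[OF nth_deriv_cong_ev] that
    by (auto simp: borel_fun_def germ0_def fps_eq_iff)
  moreover have "f \<in> germ0 f" by (simp add: germ0_def)
  ultimately have "borel_fun ` germ0 f = {borel_fun f}" by blast
  then show ?thesis by (simp add: borel_map_def)
qed

section \<open>Spaces of formal power series\<close>

definition coeffs_bounded :: "real \<Rightarrow> (nat \<Rightarrow> real) \<Rightarrow> complex fps \<Rightarrow> bool" where
  "coeffs_bounded h M F \<longleftrightarrow>
     bdd_above (range (\<lambda>j. norm (fps_nth F j) / (h ^ j * (M j / fact j))))"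

definition F_roumieu :: "(real \<Rightarrow> nat \<Rightarrow> real) \<Rightarrow> complex fps set" where
  "F_roumieu \<M> = {F. \<exists>\<mu>>0. \<exists>h>0. coeffs_bounded h (\<M> \<mu>) F}"

definition F_beurling :: "(real \<Rightarrow> nat \<Rightarrow> real) \<Rightarrow> complex fps set" where
  "F_beurling \<M> = {F. \<forall>\<mu>>0. \<forall>h>0. coeffs_bounded h (\<M> \<mu>) F}"

definition hadamard :: "complex fps \<Rightarrow> complex fps \<Rightarrow> complex fps" (infixl \<open>\<odot>\<close> 70) where
  "F \<odot> G = Abs_fps (\<lambda>j. fps_nth F j * fps_nth G j)"

section \<open>Algebrability with respect to the pointwise product\<close>

text \<open>A unit is not required. The product \<open>fps_const c * F\<close> is scalar multiplication.\<close>

definition hadamard_subalgebra :: "complex fps set \<Rightarrow> bool" where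
  "hadamard_subalgebra C \<longleftrightarrow>
     0 \<in> C \<and>
     (\<forall>F\<in>C. \<forall>G\<in>C. F + G \<in> C) \<and>
     (\<forall>c. \<forall>F\<in>C. fps_const c * F \<in> C) \<and>
     (\<forall>F\<in>C. \<forall>G\<in>C. F \<odot> G \<in> C)"

definition minimal_generators :: "complex fps set \<Rightarrow> complex fps set \<Rightarrow> bool" where
  "minimal_generators C S \<longleftrightarrow>
     hadamard_subalgebra hull S = C \<and> (\<forall>T. T \<subset> S \<longrightarrow> hadamard_subalgebra hull T \<noteq> C)"

definition generated_by_card :: "complex fps set \<Rightarrow> 'k rel \<Rightarrow> bool" where
  "generated_by_card C \<kappa> \<longleftrightarrow> (\<exists>S. minimal_generators C S \<and> (card_of S, \<kappa>) \<in> ordIso)"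

text \<open>\<open>algebrable_in A \<kappa> B\<close>: the subset \<open>B\<close> of the algebra \<open>A\<close> (a subspace of the formal
  power series closed under \<open>\<odot>\<close>) is \<open>\<kappa>\<close>-algebrable, for a cardinal \<open>\<kappa>\<close>.\<close>

definition algebrable_in :: "complex fps set \<Rightarrow> 'k rel \<Rightarrow> complex fps set \<Rightarrow> bool" where
  "algebrable_in A \<kappa> B \<longleftrightarrow>
     B \<subseteq> A \<and>
     (\<exists>C. hadamard_subalgebra C \<and> C \<subseteq> A \<and> generated_by_card C \<kappa> \<and> C \<subseteq> B \<union> {0})"

abbreviation continuum :: "real rel" where
  "continuum \<equiv> card_of (UNIV :: real set)"

section \<open>Growth conditions\<close>

definition growth_roumieu :: "(real \<Rightarrow> nat \<Rightarrow> real) \<Rightarrow> bool" where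
  "growth_roumieu \<N> \<longleftrightarrow> (\<forall>\<mu>>0. \<exists>\<kappa>>0. \<exists>C>0. \<exists>h>0. \<forall>j.
     (\<N> \<mu> j / fact j)\<^sup>2 \<le> C * h ^ j * (\<N> \<kappa> j / fact j))"

definition growth_beurling :: "(real \<Rightarrow> nat \<Rightarrow> real) \<Rightarrow> bool" where
  "growth_beurling \<N> \<longleftrightarrow> (\<forall>\<mu>>0. \<exists>\<kappa>>0. \<exists>C>0. \<exists>h>0. \<forall>j.
     (\<N> \<kappa> j / fact j)\<^sup>2 \<le> C * h ^ j * (\<N> \<mu> j / fact j))"

lemma coeffs_bounded_iff:
  assumes "weight_sequence M" "h > 0"
  shows "coeffs_bounded h M F \<longleftrightarrow>
    (\<exists>B>0. \<forall>j. norm (fps_nth F j) \<le> B * (h ^ j * (M j / fact j)))"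
proof -
  have pos: "h ^ j * (M j / fact j) > 0" for j
    using assms by (simp add: weight_sequence_def)
  have "coeffs_bounded h M F \<longleftrightarrow> (\<exists>B. \<forall>j. norm (fps_nth F j) \<le> B * (h ^ j * (M j / fact j)))"
    unfolding coeffs_bounded_def bdd_above_def using pos by (simp only: ball_simps pos_divide_le_eq)
  moreover have "\<exists>B>0. \<forall>j. norm (fps_nth F j) \<le> B * (h ^ j * (M j / fact j))"
    if "\<forall>j. norm (fps_nth F j) \<le> B * (h ^ j * (M j / fact j))" for B
  proof (intro exI[of _ "max B 1"] conjI allI)
    fix j
    have "B * (h ^ j * (M j / fact j)) \<le> max B 1 * (h ^ j * (M j / fact j))"
      using pos[of j] by (intro mult_right_mono) auto
    then show "norm (fps_nth F j) \<le> max B 1 * (h ^ j * (M j / fact j))"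
      using that order_trans by blast
  qed auto
  ultimately show ?thesis by blast
qed

lemma coeffs_bounded_add:
  assumes "weight_sequence M" "h > 0" "coeffs_bounded h M F" "coeffs_bounded h M G"
  shows "coeffs_bounded h M (F + G)"
proof -
  obtain A B where AB: "A > 0" "B > 0"
    "\<And>j. norm (fps_nth F j) \<le> A * (h ^ j * (M j / fact j))"
    "\<And>j. norm (fps_nth G j) \<le> B * (h ^ j * (M j / fact j))"
    using assms coeffs_bounded_iff by metis
  have "norm (fps_nth (F + G) j) \<le> (A + B) * (h ^ j * (M j / fact j))" for j
    using norm_triangle_mono[OF AB(3)[of j] AB(4)[of j]] by (simp only: fps_add_nth distrib_right)
  then show ?thesis
    using AB coeffs_bounded_iff[OF assms(1,2)] add_pos_pos by blast
qed

lemma coeffs_bounded_scale: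
  assumes "weight_sequence M" "h > 0" "coeffs_bounded h M F"
  shows "coeffs_bounded h M (fps_const c * F)"
proof -
  obtain A where A: "A > 0" "\<And>j. norm (fps_nth F j) \<le> A * (h ^ j * (M j / fact j))"
    using assms coeffs_bounded_iff by metis
  have "norm (fps_nth (fps_const c * F) j) \<le> (norm c + 1) * A * (h ^ j * (M j / fact j))" for j
    using mult_mono[OF _ A(2)[of j], of "norm c" "norm c + 1"]
    by (simp add: norm_mult mult.assoc)
  moreover have "(norm c + 1) * A > 0" using A by (simp add: add_nonneg_pos)
  ultimately show ?thesis using coeffs_bounded_iff[OF assms(1,2)] by blast
qed

lemma coeffs_bounded_mono:
  assumes "weight_sequence M" "weight_sequence N" "\<And>j. M j \<le> N j" "0 < h" "h \<le> k"
    "coeffs_bounded h M F"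
  shows "coeffs_bounded k N F"
proof -
  obtain A where A: "A > 0" "\<And>j. norm (fps_nth F j) \<le> A * (h ^ j * (M j / fact j))"
    using assms coeffs_bounded_iff by metis
  have "norm (fps_nth F j) \<le> A * (k ^ j * (N j / fact j))" for j
  proof -
    have "A * (h ^ j * (M j / fact j)) \<le> A * (k ^ j * (N j / fact j))"
      using A(1) assms
      by (intro mult_left_mono mult_mono power_mono divide_right_mono)
         (auto simp: weight_sequence_def less_imp_le)
    then show ?thesis using A(2) order_trans by blast
  qed
  moreover have "k > 0" using assms(4,5) by linarith
  ultimately show ?thesis
    using A(1) coeffs_bounded_iff[OF assms(2)] by blast
qed

lemma coeffs_bounded_hadamard:
  assumes "weight_sequence M" "weight_sequence N" "0 < h" "0 < k" "0 < c" "0 < C"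
    and sq: "\<And>j. (M j / fact j)\<^sup>2 \<le> C * c ^ j * (N j / fact j)"
    and FG: "coeffs_bounded h M F" "coeffs_bounded k M G"
  shows "coeffs_bounded (h * k * c) N (F \<odot> G)"
proof -
  obtain A B where AB: "A > 0" "B > 0"
    "\<And>j. norm (fps_nth F j) \<le> A * (h ^ j * (M j / fact j))"
    "\<And>j. norm (fps_nth G j) \<le> B * (k ^ j * (M j / fact j))"
    using assms coeffs_bounded_iff by metis
  have "norm (fps_nth (F \<odot> G) j) \<le> A * B * C * ((h * k * c) ^ j * (N j / fact j))" for j
  proof -
    have "norm (fps_nth (F \<odot> G) j)
        \<le> (A * (h ^ j * (M j / fact j))) * (B * (k ^ j * (M j / fact j)))"
      using mult_mono'[OF AB(3)[of j] AB(4)[of j]] by (simp add: hadamard_def norm_mult)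
    also have "\<dots> = (A * B * (h ^ j * k ^ j)) * (M j / fact j)\<^sup>2"
      by (simp add: power2_eq_square)
    also have "\<dots> \<le> (A * B * (h ^ j * k ^ j)) * (C * c ^ j * (N j / fact j))"
      using AB assms by (intro mult_left_mono sq) auto
    also have "\<dots> = A * B * C * ((h * k * c) ^ j * (N j / fact j))"
      by (simp add: power_mult_distrib)
    finally show ?thesis .
  qed
  moreover have "A * B * C > 0" "h * k * c > 0" using AB assms by auto
  ultimately show ?thesis using coeffs_bounded_iff[OF assms(2)] by blast
qed

lemma coeffs_bounded_0: "coeffs_bounded h M 0"
  by (simp add: coeffs_bounded_def)

text \<open>The spaces in which algebrability is considered are algebras.\<close>

lemma hadamard_subalgebra_F_roumieu:
  assumes N: "weight_matrix \<N>" and g: "growth_roumieu \<N>"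
  shows "hadamard_subalgebra (F_roumieu \<N>)"
proof -
  have ws: "\<mu> > 0 \<Longrightarrow> weight_sequence (\<N> \<mu>)" for \<mu> using N by (simp add: weight_matrix_def)
  have common: "\<exists>\<mu>>0. \<exists>h>0. coeffs_bounded h (\<N> \<mu>) F \<and> coeffs_bounded h (\<N> \<mu>) G"
    if F: "F \<in> F_roumieu \<N>" and G: "G \<in> F_roumieu \<N>" for F G
  proof -
    obtain \<mu> h where 1: "\<mu> > 0" "h > 0" "coeffs_bounded h (\<N> \<mu>) F"
      using F by (auto simp: F_roumieu_def)
    obtain \<nu> k where 2: "\<nu> > 0" "k > 0" "coeffs_bounded k (\<N> \<nu>) G"
      using G by (auto simp: F_roumieu_def)
    have "coeffs_bounded (max h k) (\<N> (max \<mu> \<nu>)) F"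
      using 1 2 N by (intro coeffs_bounded_mono[OF _ _ _ _ _ 1(3)] ws) (auto simp: weight_matrix_def)
    moreover have "coeffs_bounded (max h k) (\<N> (max \<mu> \<nu>)) G"
      using 1 2 N by (intro coeffs_bounded_mono[OF _ _ _ _ _ 2(3)] ws) (auto simp: weight_matrix_def)
    moreover have "max \<mu> \<nu> > 0" "max h k > 0" using 1 2 by auto
    ultimately show ?thesis by blast
  qed
  show ?thesis
    unfolding hadamard_subalgebra_def
  proof (intro conjI ballI allI)
    show "0 \<in> F_roumieu \<N>"
      using coeffs_bounded_0 zero_less_one unfolding F_roumieu_def by blast
    fix F G assume FG: "F \<in> F_roumieu \<N>" "G \<in> F_roumieu \<N>"
    obtain \<mu> h where c: "\<mu> > 0" "h > 0" "coeffs_bounded h (\<N> \<mu>) F" "coeffs_bounded h (\<N> \<mu>) G"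
      using common[OF FG] by blast
    show "F + G \<in> F_roumieu \<N>"
      using c coeffs_bounded_add ws unfolding F_roumieu_def by blast
    obtain \<kappa> C k where k: "\<kappa> > 0" "C > 0" "k > 0"
      "\<And>j. (\<N> \<mu> j / fact j)\<^sup>2 \<le> C * k ^ j * (\<N> \<kappa> j / fact j)"
      using g c(1) unfolding growth_roumieu_def by metis
    have "coeffs_bounded (h * h * k) (\<N> \<kappa>) (F \<odot> G)"
      using coeffs_bounded_hadamard[OF ws[OF c(1)] ws[OF k(1)] c(2) c(2) k(3) k(2) k(4) c(3) c(4)] .
    moreover have "h * h * k > 0" using c k by simp
    ultimately show "F \<odot> G \<in> F_roumieu \<N>"
      using k(1) unfolding F_roumieu_def by blast
  next
    fix c F assume "F \<in> F_roumieu \<N>"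
    then show "fps_const c * F \<in> F_roumieu \<N>"
      using coeffs_bounded_scale ws unfolding F_roumieu_def by blast
  qed
qed

lemma hadamard_subalgebra_F_beurling:
  assumes N: "weight_matrix \<N>" and g: "growth_beurling \<N>"
  shows "hadamard_subalgebra (F_beurling \<N>)"
proof -
  have ws: "\<mu> > 0 \<Longrightarrow> weight_sequence (\<N> \<mu>)" for \<mu> using N by (simp add: weight_matrix_def)
  show ?thesis
    unfolding hadamard_subalgebra_def
  proof (intro conjI ballI allI)
    show "0 \<in> F_beurling \<N>"
      using coeffs_bounded_0 unfolding F_beurling_def by blast
    fix F G assume FG: "F \<in> F_beurling \<N>" "G \<in> F_beurling \<N>"
    show "F + G \<in> F_beurling \<N>"
      unfolding F_beurling_def
    proof (clarify)
      fix \<mu> h :: real assume "\<mu> > 0" "h > 0"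
      then show "coeffs_bounded h (\<N> \<mu>) (F + G)"
        using FG by (intro coeffs_bounded_add ws) (simp_all add: F_beurling_def)
    qed
    have "coeffs_bounded h (\<N> \<mu>) (F \<odot> G)" if p: "\<mu> > 0" "h > 0" for \<mu> h
    proof -
      obtain \<kappa> C k where k: "\<kappa> > 0" "C > 0" "k > 0"
        "\<And>j. (\<N> \<kappa> j / fact j)\<^sup>2 \<le> C * k ^ j * (\<N> \<mu> j / fact j)"
        using g p(1) unfolding growth_beurling_def by metis
      have hk: "h / k > 0" using p k(3) by simp
      have "coeffs_bounded 1 (\<N> \<kappa>) F" "coeffs_bounded (h / k) (\<N> \<kappa>) G"
        using FG k(1) hk by (simp_all add: F_beurling_def)
      then have "coeffs_bounded (1 * (h / k) * k) (\<N> \<mu>) (F \<odot> G)"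
        using coeffs_bounded_hadamard[OF ws[OF k(1)] ws[OF p(1)] zero_less_one hk k(3) k(2) k(4)]
        by blast
      then show ?thesis using k(3) by simp
    qed
    then show "F \<odot> G \<in> F_beurling \<N>" by (simp add: F_beurling_def)
  next
    fix c F assume "F \<in> F_beurling \<N>"
    then show "fps_const c * F \<in> F_beurling \<N>"
      by (simp add: F_beurling_def coeffs_bounded_scale ws)
  qed
qed

end

theory Submission
  imports Defs
begin

text \<open>
  Quasianalyticity enters through a one-sided version of Bang's argument. If
  \<open>g\<close> is real with \<open>\<bar>g\<^sup>(\<^sup>n\<^sup>)\<bar> \<le> M n\<close> on \<open>[0,a]\<close> and all but finitely many derivatives at \<open>0\<close> are
  nonnegative, consider the property \<open>- g\<^sup>(\<^sup>n\<^sup>)(x) \<le> e\<^sup>n\<^sup>-\<^sup>k M n\<close> for all large \<open>n\<close>. Going from \<open>k + 1\<close>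
  to \<open>k\<close> it survives a step to the right of length \<open>M k / (e M (k + 1))\<close>, by Taylor's formula up to
  order \<open>k + 1\<close> and log-convexity. At \<open>x = 0\<close> it holds for every \<open>k\<close>, and the steps have divergent
  sum, so it holds for every \<open>k\<close> on all of \<open>[0,a]\<close>. Hence these derivatives are nonnegative on
  \<open>[0,a]\<close>, and Taylor's formula bounds \<open>g\<^sup>(\<^sup>n\<^sup>)(0) / n!\<close> geometrically.

  A non-analytic germ in the class of \<open>\<N>\<close> gives, through the maxima of its derivatives on a compact
  interval, a series whose coefficients are not geometrically bounded; discarding the \<open>j\<close>-th
  coefficient when it is below \<open>2\<^sup>j\<close> leaves a sequence \<open>F\<close>. The algebra is generated by the real
  powers \<open>F\<^sup>\<alpha>\<close> with \<open>1 < \<alpha> < 2\<close>. In a nonzero linear combination of powers the largest exponent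
  dominates, so after multiplication by a constant the real parts of the coefficients are eventually
  nonnegative and not geometrically bounded. Such a series is not in the image of the Borel map.
\<close>

section \<open>Bang's theorem on derivatives of one sign\<close>

lemma log_convex_ratio_mono:
  fixes M :: "nat \<Rightarrow> real"
  assumes pos: "\<And>n. 0 < M n" and lc: "\<And>n. 1 \<le> n \<Longrightarrow> (M n)\<^sup>2 \<le> M (n - 1) * M (n + 1)"
    and "m \<le> k"
  shows "M (Suc m) / M m \<le> M (Suc k) / M k"
proof -
  have "M (Suc n) / M n \<le> M (Suc (Suc n)) / M (Suc n)" for n
    using lc[of "Suc n"] pos[of n] pos[of "Suc n"] by (simp add: field_simps power2_eq_square)
  then have "incseq (\<lambda>n. M (Suc n) / M n)" by (rule incseq_SucI)
  then show ?thesis using \<open>m \<le> k\<close> by (auto simp: incseq_def)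
qed

text \<open>Each of the \<open>i\<close> successive ratios leading from \<open>M n\<close> to
  \<open>M (n + i)\<close> is at most \<open>M (Suc k) / M k\<close>, since the ratios increase and
  none of those used lies beyond index \<open>k\<close>.\<close>

lemma log_convex_growth:
  fixes M :: "nat \<Rightarrow> real"
  assumes pos: "\<And>n. 0 < M n" and lc: "\<And>n. 1 \<le> n \<Longrightarrow> (M n)\<^sup>2 \<le> M (n - 1) * M (n + 1)"
    and "n + i \<le> Suc k"
  shows "M (n + i) \<le> M n * (M (Suc k) / M k) ^ i"
  using \<open>n + i \<le> Suc k\<close>
proof (induction i)
  case (Suc i)
  let ?r = "M (Suc k) / M k"
  have "M (n + Suc i) = M (n + i) * (M (Suc (n + i)) / M (n + i))"
    using pos[of "n + i"] by simp
  also have "\<dots> \<le> (M n * ?r ^ i) * ?r"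
    using Suc log_convex_ratio_mono[OF pos lc, of "n + i" k] pos
    by (intro mult_mono) (auto simp: less_imp_le)
  finally show ?case by (simp add: mult_ac)
qed simp

lemma sum_inverse_fact_le_exp: "(\<Sum>i\<le>p. 1 / fact i) \<le> exp (1::real)"
proof -
  have "(\<lambda>i. 1 / fact i) sums exp (1::real)"
    using exp_converges[of "1::real"] by (simp add: field_simps)
  then show ?thesis
    using sum_le_suminf[of "\<lambda>i. 1 / fact i :: real" "{..p}"] by (simp add: sums_iff)
qed

text \<open>For a step this short, \<open>(y - x) ^ i\<close> compensates both the growth of
  \<open>M\<close> and the factor \<open>exp i\<close>, so every Taylor term is at most
  \<open>exp (n - k - 1) * M n / fact i\<close>. Summing the inverse factorials costs one factor e,
  which is exactly the passage from \<open>k + 1\<close> to \<open>k\<close>.\<close>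

lemma bang_step:
  fixes g :: "nat \<Rightarrow> real \<Rightarrow> real" and M :: "nat \<Rightarrow> real"
  assumes pos: "\<And>n. 0 < M n" and lc: "\<And>n. 1 \<le> n \<Longrightarrow> (M n)\<^sup>2 \<le> M (n - 1) * M (n + 1)"
    and deriv: "\<And>n x. x \<in> {0..a} \<Longrightarrow> (g n has_real_derivative g (Suc n) x) (at x)"
    and bound: "\<And>n x. x \<in> {0..a} \<Longrightarrow> \<bar>g n x\<bar> \<le> M n"
    and at_x: "\<And>n. J \<le> n \<Longrightarrow> - g n x \<le> exp (real n - real (Suc k)) * M n"
    and xy: "0 \<le> x" "x \<le> y" "y \<le> a" "y - x \<le> M k / (exp 1 * M (Suc k))"
    and n: "J \<le> n"
  shows "- g n y \<le> exp (real n - real k) * M n"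
proof (cases "x = y \<or> Suc k \<le> n")
  case True
  then show ?thesis
  proof
    assume "x = y"
    have "exp (real n - real (Suc k)) * M n \<le> exp (real n - real k) * M n"
      using pos[of n] by (intro mult_right_mono) auto
    then show ?thesis using at_x[OF n] \<open>x = y\<close> by (simp del: of_nat_Suc)
  next
    \<comment> \<open>At orders above \<open>k\<close> the exponential factor is at least 1, so the
      two-sided bound suffices.\<close>
    assume "Suc k \<le> n"
    then have "1 * M n \<le> exp (real n - real k) * M n"
      using pos[of n] by (intro mult_right_mono) auto
    then show ?thesis using bound[of y n] xy by auto
  qed
next
  case False
  define d where "d = y - x"
  \<comment> \<open>The remainder then has order exactly \<open>Suc k\<close>, where the required
    estimate is just \<open>bound\<close>; no sign information at the intermediate point is
    needed.\<close>
  define p where "p = Suc k - n"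
  define r where "r = M (Suc k) / M k"
  have d: "d > 0" and p: "p > 0" "n + p = Suc k" using False xy by (auto simp: d_def p_def)
  have "\<exists>t. (if y < x then y < t \<and> t < x else x < t \<and> t < y) \<and>
      g n y = (\<Sum>m<p. (g (n + m) x / fact m) * (y - x)^m) + (g (n + p) t / fact p) * (y - x)^p"
    using xy False p deriv by (intro Taylor[where a = 0 and b = a]) auto
  then obtain t where t: "x < t" "t < y"
    and eq: "g n y = (\<Sum>m<p. (g (n + m) x / fact m) * d^m) + (g (n + p) t / fact p) * d^p"
    using xy by (auto simp: d_def)
  have r: "r > 0" using pos by (simp add: r_def)
  have "d \<le> 1 / (exp 1 * r)" using xy by (simp add: d_def r_def)
  then have "d * (exp 1 * r) \<le> 1" using r by (simp add: field_simps)
  then have "(d * (exp 1 * r)) ^ i \<le> 1" for i using d r by (intro power_le_one) auto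
  then have small: "exp (real i) * r ^ i * d ^ i \<le> 1" for i
    by (simp add: power_mult_distrib mult_ac flip: exp_of_nat_mult)
  \<comment> \<open>One estimate for the Taylor terms at \<open>x\<close> and for the remainder at
    \<open>t\<close>; \<open>v\<close> stands for a negated derivative.\<close>
  have term_le: "v / fact i * d ^ i \<le> exp (real n - real (Suc k)) * M n * (1 / fact i)"
    if "n + i \<le> Suc k" "v \<le> exp (real (n + i) - real (Suc k)) * M (n + i)" for v i
  proof -
    have "v * d ^ i \<le> (exp (real (n + i) - real (Suc k)) * (M n * r ^ i)) * d ^ i"
      using that log_convex_growth[OF pos lc that(1)] d
      by (intro mult_right_mono) (auto simp: r_def intro: order_trans)
    also have "\<dots> = (exp (real n - real (Suc k)) * M n) * (exp (real i) * r ^ i * d ^ i)"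
      by (simp add: exp_add exp_diff)
    also have "\<dots> \<le> (exp (real n - real (Suc k)) * M n) * 1"
      using small pos[of n] by (intro mult_left_mono) auto
    finally show ?thesis by (simp add: divide_right_mono)
  qed
  have "- g n y = (\<Sum>m<p. ((- g (n + m) x) / fact m) * d^m) + ((- g (n + p) t) / fact p) * d^p"
    by (simp add: eq sum_negf)
  also have "\<dots> \<le> (\<Sum>m<p. exp (real n - real (Suc k)) * M n * (1 / fact m))
      + exp (real n - real (Suc k)) * M n * (1 / fact p)"
  proof (intro add_mono sum_mono term_le)
    show "- g (n + m) x \<le> exp (real (n + m) - real (Suc k)) * M (n + m)" for m
      using at_x[of "n + m"] n by simp
    show "- g (n + p) t \<le> exp (real (n + p) - real (Suc k)) * M (n + p)"
      using bound[of t "n + p"] t xy p by simp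
  qed (use p in auto)
  also have "\<dots> = exp (real n - real (Suc k)) * M n * (\<Sum>m\<le>p. 1 / fact m)"
    by (simp add: sum_distrib_left distrib_left flip: lessThan_Suc_atMost)
  also have "\<dots> \<le> exp (real n - real (Suc k)) * M n * exp 1"
    using pos[of n] sum_inverse_fact_le_exp by (intro mult_left_mono) auto
  also have "\<dots> = exp (real n - real k) * M n" by (simp add: exp_diff exp_add)
  finally show ?thesis .
qed

text \<open>For each \<open>k\<close>, the divergent sum lets finitely many steps with indices above
  \<open>k\<close> lead from 0 to \<open>x\<close>. The resulting bound
  \<open>exp (n - k) * M n\<close> tends to 0 as \<open>k\<close> grows.\<close>

lemma bang_nonneg:
  fixes g :: "nat \<Rightarrow> real \<Rightarrow> real" and M :: "nat \<Rightarrow> real"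
  assumes pos: "\<And>n. 0 < M n" and lc: "\<And>n. 1 \<le> n \<Longrightarrow> (M n)\<^sup>2 \<le> M (n - 1) * M (n + 1)"
    and qa: "quasianalytic M"
    and deriv: "\<And>n x. x \<in> {0..a} \<Longrightarrow> (g n has_real_derivative g (Suc n) x) (at x)"
    and bound: "\<And>n x. x \<in> {0..a} \<Longrightarrow> \<bar>g n x\<bar> \<le> M n"
    and nonneg: "\<And>n. J \<le> n \<Longrightarrow> 0 \<le> g n 0"
    and x: "x \<in> {0..a}" and n: "J \<le> n"
  shows "0 \<le> g n x"
proof -
  define s where "s j = M (j - 1) / (exp 1 * M j)" for j
  have s_pos: "s j > 0" for j using pos by (simp add: s_def)
  \<comment> \<open>The walk starts at 0 on level \<open>N\<close>; level \<open>k\<close> reaches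
    the points within the total length of the steps \<open>k + 1\<close> to
    \<open>N\<close>.\<close>
  have reach: "\<forall>x n. 0 \<le> x \<longrightarrow> x \<le> a \<longrightarrow> x \<le> (\<Sum>j=Suc k..N. s j) \<longrightarrow> J \<le> n \<longrightarrow>
      - g n x \<le> exp (real n - real k) * M n" if "k \<le> N" for k N
    using that
  proof (induction k rule: inc_induct)
    case base
    \<comment> \<open>For \<open>k = N\<close> the sum of steps is empty, so only the point 0 is in
      question.\<close>
    have "- g n 0 \<le> exp (real n - real N) * M n" if "J \<le> n" for n
      using nonneg[OF that] pos[of n] by (smt (verit) exp_gt_zero mult_pos_pos)
    then show ?case by (auto dest: order_antisym)
  next
    case (step k)
    show ?case
    proof (intro allI impI)
      fix x n assume *: "0 \<le> x" "x \<le> a" "x \<le> (\<Sum>j=Suc k..N. s j)" "J \<le> n"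
      \<comment> \<open>One step back from \<open>x\<close>, cut off at 0 to remain in the
        interval.\<close>
      define x' where "x' = max 0 (x - s (Suc k))"
      have "(\<Sum>j=Suc k..N. s j) = s (Suc k) + (\<Sum>j=Suc (Suc k)..N. s j)"
        using step.hyps by (simp add: sum.atLeast_Suc_atMost)
      moreover have "0 \<le> (\<Sum>j=Suc (Suc k)..N. s j)" using s_pos by (simp add: sum_nonneg less_imp_le)
      ultimately have x': "0 \<le> x'" "x' \<le> x" "x' \<le> (\<Sum>j=Suc (Suc k)..N. s j)" "x - x' \<le> s (Suc k)"
        using * s_pos[of "Suc k"] by (auto simp: x'_def)
      show "- g n x \<le> exp (real n - real k) * M n"
        by (rule bang_step[where M = M and g = g and a = a and x = x' and J = J])
           (use pos lc deriv bound step.IH x' * in \<open>auto simp: s_def\<close>)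
    qed
  qed
  have "- g n x \<le> exp (real n - real k) * M n" for k
  proof -
    have "filterlim (\<lambda>N. \<Sum>j=1..N. M (j - 1) / M j) at_top sequentially"
      using qa by (simp add: quasianalytic_def)
    \<comment> \<open>\<open>N\<close> is chosen so that the steps after \<open>k\<close> have total
      length at least \<open>x\<close>; the first \<open>k\<close> steps are added on both sides to
      compare full partial sums.\<close>
    then have "\<forall>\<^sub>F N in sequentially. exp 1 * (x + (\<Sum>j=1..k. s j)) \<le> (\<Sum>j=1..N. M (j - 1) / M j)"
      by (simp add: filterlim_at_top)
    with eventually_ge_at_top[of k]
    have "\<forall>\<^sub>F N in sequentially. k \<le> N \<and> exp 1 * (x + (\<Sum>j=1..k. s j)) \<le> (\<Sum>j=1..N. M (j - 1) / M j)"
      by eventually_elim simp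
    then obtain N where N: "k \<le> N" "exp 1 * (x + (\<Sum>j=1..k. s j)) \<le> (\<Sum>j=1..N. M (j - 1) / M j)"
      using eventually_happens'[OF sequentially_bot] by blast
    have "(\<Sum>j=1..N. M (j - 1) / M j) = exp 1 * (\<Sum>j=1..N. s j)"
      by (simp add: sum_distrib_left s_def)
    then have "x + (\<Sum>j=1..k. s j) \<le> (\<Sum>j=1..N. s j)" using N by simp
    also have "\<dots> = (\<Sum>j=1..k. s j) + (\<Sum>j=Suc k..N. s j)"
      using N(1) sum.ub_add_nat[of 1 k s "N - k"] by simp
    finally show ?thesis using reach[OF N(1)] x n by auto
  qed
  \<comment> \<open>Now \<open>k\<close> tends to infinity while \<open>n\<close> and
    \<open>x\<close> stay fixed.\<close>
  moreover have "(\<lambda>k. exp (real n - real k) * M n) \<longlonglongrightarrow> 0"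
  proof -
    have "exp (real n - real k) * M n = exp (real n) * M n * exp (- 1) ^ k" for k
    proof -
      have "exp (- 1) ^ k = exp (- real k)" using exp_of_nat_mult[of k "- 1 :: real"] by simp
      then show ?thesis using exp_add[of "real n" "- real k"] by simp
    qed
    moreover have "(\<lambda>k. exp (real n) * M n * exp (- 1) ^ k) \<longlonglongrightarrow> 0"
      by (intro tendsto_mult_right_zero LIMSEQ_realpow_zero) auto
    ultimately show ?thesis by (simp only:)
  qed
  ultimately have "- g n x \<le> 0"
    by (intro LIMSEQ_le_const[where X = "\<lambda>k. exp (real n - real k) * M n"]) auto
  then show ?thesis by simp
qed

text \<open>Expand \<open>g J\<close> at 0 and evaluate at \<open>a\<close>: the Taylor terms and,
  by Bang's argument, the remainder are nonnegative, so each single term is at most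
  \<open>g J a\<close>.\<close>

lemma bang_geometric_bound:
  fixes g :: "nat \<Rightarrow> real \<Rightarrow> real" and M :: "nat \<Rightarrow> real"
  assumes pos: "\<And>n. 0 < M n" and lc: "\<And>n. 1 \<le> n \<Longrightarrow> (M n)\<^sup>2 \<le> M (n - 1) * M (n + 1)"
    and qa: "quasianalytic M"
    and deriv: "\<And>n x. x \<in> {0..a} \<Longrightarrow> (g n has_real_derivative g (Suc n) x) (at x)"
    and bound: "\<And>n x. x \<in> {0..a} \<Longrightarrow> \<bar>g n x\<bar> \<le> M n"
    and nonneg: "\<And>n. J \<le> n \<Longrightarrow> 0 \<le> g n 0"
    and a: "a > 0" and n: "J \<le> n"
  shows "g n 0 / fact n \<le> M J * a ^ J * (1 / a) ^ n"
proof -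
  note nn = bang_nonneg[OF pos lc qa deriv bound nonneg]
  define q where "q = n - J"
  have q: "n = J + q" using n by (simp add: q_def)
  \<comment> \<open>Order \<open>Suc q\<close> keeps the term of index \<open>q\<close>, which
    carries \<open>g n 0\<close>, out of the remainder.\<close>
  have "\<exists>t. (if a < 0 then a < t \<and> t < 0 else 0 < t \<and> t < a) \<and>
      g J a = (\<Sum>m<Suc q. (g (J + m) 0 / fact m) * (a - 0)^m) + (g (J + Suc q) t / fact (Suc q)) * (a - 0)^Suc q"
    using a deriv by (intro Taylor[where a = 0 and b = a]) auto
  then obtain t where t: "0 < t" "t < a"
    and eq: "g J a = (\<Sum>m<Suc q. (g (J + m) 0 / fact m) * a^m) + (g (J + Suc q) t / fact (Suc q)) * a^Suc q"
    using a by auto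
  have "(\<Sum>m<q. (g (J + m) 0 / fact m) * a^m) \<ge> 0"
    using nonneg a by (intro sum_nonneg) auto
  moreover have "(g (J + Suc q) t / fact (Suc q)) * a^Suc q \<ge> 0"
    using nn[of t "J + Suc q"] t a by (intro mult_nonneg_nonneg divide_nonneg_nonneg) auto
  ultimately have "g n 0 / fact q * a ^ q \<le> g J a" using eq q by simp
  also have "\<dots> \<le> M J" using bound[of a J] a by auto
  finally have "g n 0 / fact q \<le> M J / a ^ q" using a by (simp add: pos_le_divide_eq)
  moreover have "g n 0 / fact n \<le> g n 0 / fact q"
    using nonneg[OF n] q by (intro divide_left_mono fact_mono) auto
  moreover have "M J / a ^ q = M J * a ^ J * (1 / a) ^ n"
    using a by (simp add: q power_add field_simps)
  ultimately show ?thesis by linarith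
qed

section \<open>Taylor coefficients of analytic and ultradifferentiable germs\<close>

lemma nth_deriv_0 [simp]: "nth_deriv 0 f = f"
  by (simp add: nth_deriv_def)

lemma nth_deriv_Suc: "nth_deriv (Suc n) f x = vector_derivative (nth_deriv n f) (at x)"
  by (simp add: nth_deriv_def)

lemma smooth_on_nth_deriv:
  assumes "smooth_on U f" "x \<in> U"
  shows "(nth_deriv n f has_vector_derivative nth_deriv (Suc n) f x) (at x)"
  using assms unfolding smooth_on_def nth_deriv_Suc by (simp add: vector_derivative_works)

text \<open>Reduces complex-valued functions to the real Taylor theorem; the factor \<open>c\<close>
  selects the real part along a chosen direction.\<close>

lemma smooth_on_Re_nth_deriv:
  assumes "smooth_on U f" "x \<in> U"
  shows "((\<lambda>x. Re (nth_deriv n f x * c)) has_real_derivative Re (nth_deriv (Suc n) f x * c)) (at x)"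
proof -
  have "bounded_linear (\<lambda>z. Re (z * c))"
    by (intro bounded_linear_compose[OF bounded_linear_Re] bounded_linear_mult_left)
  from bounded_linear.has_vector_derivative[OF this smooth_on_nth_deriv[OF assms, of n]]
  show ?thesis by (simp add: has_real_derivative_iff_has_vector_derivative)
qed

text \<open>The Lagrange remainder of order \<open>n\<close> is at most
  \<open>B * (R * \<bar>y - x\<bar>) ^ n\<close>, which tends to 0.\<close>

lemma taylor_sums:
  fixes g :: "nat \<Rightarrow> real \<Rightarrow> real"
  assumes deriv: "\<And>n t. t \<in> {-b..b} \<Longrightarrow> (g n has_real_derivative g (Suc n) t) (at t)"
    and bound: "\<And>n t. t \<in> {-b..b} \<Longrightarrow> \<bar>g n t\<bar> \<le> B * R ^ n * fact n"
    and xy: "x \<in> {-b..b}" "y \<in> {-b..b}" "R * \<bar>y - x\<bar> < 1" "0 < R"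
  shows "(\<lambda>n. g n x / fact n * (y - x) ^ n) sums g 0 y"
proof (cases "y = x")
  case True
  then show ?thesis using powser_sums_zero[of "\<lambda>n. g n x / fact n"] by simp
next
  case False
  have rem: "norm ((\<Sum>m<n. g m x / fact m * (y - x) ^ m) - g 0 y) \<le> B * (R * \<bar>y - x\<bar>) ^ n"
    if "0 < n" for n
  proof -
    have "\<exists>t. (if y < x then y < t \<and> t < x else x < t \<and> t < y) \<and>
        g 0 y = (\<Sum>m<n. (g m x / fact m) * (y - x)^m) + (g n t / fact n) * (y - x)^n"
      using xy deriv False that by (intro Taylor[where a = "-b" and b = b]) auto
    then obtain t where "(if y < x then y < t \<and> t < x else x < t \<and> t < y)"
      and eq: "g 0 y = (\<Sum>m<n. (g m x / fact m) * (y - x)^m) + (g n t / fact n) * (y - x)^n"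
      by blast
    then have t: "t \<in> {-b..b}" using xy(1,2) by (auto split: if_splits)
    have "norm ((\<Sum>m<n. g m x / fact m * (y - x) ^ m) - g 0 y) = \<bar>g n t\<bar> / fact n * \<bar>y - x\<bar> ^ n"
      by (simp add: eq abs_mult power_abs)
    also have "\<dots> \<le> B * R ^ n * \<bar>y - x\<bar> ^ n"
      using bound[OF t, of n] by (intro mult_right_mono) (auto simp: pos_divide_le_eq)
    finally show ?thesis by (simp add: power_mult_distrib mult.assoc)
  qed
  have "(\<lambda>n. (\<Sum>m<n. g m x / fact m * (y - x) ^ m) - g 0 y) \<longlonglongrightarrow> 0"
  proof (rule Lim_null_comparison)
    show "\<forall>\<^sub>F n in sequentially. norm ((\<Sum>m<n. g m x / fact m * (y - x) ^ m) - g 0 y)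
        \<le> B * (R * \<bar>y - x\<bar>) ^ n"
      using rem by (auto intro: eventually_sequentiallyI[of 1])
    show "(\<lambda>n. B * (R * \<bar>y - x\<bar>) ^ n) \<longlonglongrightarrow> 0"
      using xy by (intro tendsto_mult_right_zero LIMSEQ_realpow_zero) auto
  qed
  then show ?thesis by (simp add: sums_def LIM_zero_iff)
qed

text \<open>Cauchy-type bounds make the Taylor series at every nearby point converge to
  \<open>f\<close>. They are available on the half interval only, so the germ is represented with
  \<open>2 * k\<close> in place of \<open>k\<close>.\<close>

lemma real_analytic_germ:
  assumes sm: "smooth_on {- 1 / real k<..<1 / real k} f" and k: "1 \<le> k"
    and bound: "\<And>n t. \<bar>t\<bar> \<le> 1 / (2 * real k) \<Longrightarrow> norm (nth_deriv n f t) \<le> B * R ^ n * fact n"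
    and R: "0 < R"
  shows "germ0 f \<in> germs0 real_analytic"
proof -
  define b where "b = 1 / (2 * real k)"
  have inU: "t \<in> {- 1 / real k<..<1 / real k}" if "t \<in> {-b..b}" for t
  proof -
    have "b < 1 / real k" using k by (simp add: b_def field_simps)
    then show ?thesis using that by auto
  qed
  have "f \<in> real_analytic {- 1 / real (2 * k)<..<1 / real (2 * k)}"
    unfolding real_analytic_def mem_Collect_eq
  proof
    fix x assume "x \<in> {- 1 / real (2 * k)<..<1 / real (2 * k)}"
    then have x: "\<bar>x\<bar> < b" by (auto simp: b_def)
    \<comment> \<open>Keeps \<open>y\<close> where the bounds hold and within the radius
      \<open>1 / R\<close> in which the remainder decays.\<close>
    define r where "r = min (b - \<bar>x\<bar>) (1 / R)"
    have r: "r > 0" using x R by (simp add: r_def)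
    have "(\<lambda>n. nth_deriv n f x / fact n * complex_of_real (y - x) ^ n) sums f y" if y: "\<bar>y - x\<bar> < r" for y
    proof -
      have yb: "x \<in> {-b..b}" "y \<in> {-b..b}" "R * \<bar>y - x\<bar> < 1"
        using x y R by (auto simp: r_def field_simps abs_if split: if_splits)
      \<comment> \<open>\<open>c = 1\<close> yields the real part of the expansion and
        \<open>c = - \<i>\<close> the imaginary part.\<close>
      have part: "(\<lambda>n. Re (nth_deriv n f x * c) / fact n * (y - x) ^ n) sums Re (nth_deriv 0 f y * c)"
        if c: "norm c = 1" for c
      proof (rule taylor_sums[where b = b and B = B and R = R and g = "\<lambda>n t. Re (nth_deriv n f t * c)"])
        fix n t assume t: "t \<in> {-b..b}"
        show "((\<lambda>t. Re (nth_deriv n f t * c)) has_real_derivative Re (nth_deriv (Suc n) f t * c)) (at t)"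
          by (rule smooth_on_Re_nth_deriv[OF sm inU[OF t]])
        have "\<bar>Re (nth_deriv n f t * c)\<bar> \<le> norm (nth_deriv n f t)"
          using abs_Re_le_cmod[of "nth_deriv n f t * c"] c by (simp add: norm_mult)
        also have "\<dots> \<le> B * R ^ n * fact n" using t by (intro bound) (auto simp: b_def)
        finally show "\<bar>Re (nth_deriv n f t * c)\<bar> \<le> B * R ^ n * fact n" .
      qed (use yb R in auto)
      have split: "nth_deriv n f x / fact n * complex_of_real (y - x) ^ n
          = nth_deriv n f x * of_real ((y - x) ^ n / fact n)" for n
        by simp
      have Re_Im: "Re (z * of_real s) = Re z * s" "Im (z * of_real s) = Im z * s" for z s
        by simp_all
      show ?thesis
        unfolding sums_complex_iff split Re_Im using part[of 1] part[of "- \<i>"] by simp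
    qed
    then show "\<exists>a. \<exists>r>0. \<forall>y. \<bar>y - x\<bar> < r \<longrightarrow> (\<lambda>n. a n * complex_of_real (y - x) ^ n) sums f y"
      using r by (intro exI[of _ "\<lambda>n. nth_deriv n f x / fact n"] exI[of _ r] conjI allI impI)
  qed
  then show ?thesis using k unfolding germs0_def by (intro UN_I[of "2 * k"]) auto
qed

text \<open>A bound from above only. For nonnegative \<open>G\<close> it says that the power series
  with coefficients \<open>G j\<close> has positive radius of convergence.\<close>

definition geometrically_bounded :: "(nat \<Rightarrow> real) \<Rightarrow> bool" where
  "geometrically_bounded G \<longleftrightarrow> (\<exists>B. \<exists>R>0. \<forall>j. G j \<le> B * R ^ j)"

lemma geometrically_boundedI:
  assumes "0 < R" "\<And>j. J \<le> j \<Longrightarrow> G j \<le> B * R ^ j"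
  shows "geometrically_bounded G"
proof -
  define B' where "B' = \<bar>B\<bar> + (\<Sum>i<J. \<bar>G i\<bar> / R ^ i)"
  have "G j \<le> B' * R ^ j" for j
  proof (cases "J \<le> j")
    case True
    have "B \<le> B'" using \<open>0 < R\<close> by (simp add: B'_def abs_le_iff sum_nonneg add_increasing2)
    then have "B * R ^ j \<le> B' * R ^ j" using \<open>0 < R\<close> by (intro mult_right_mono) auto
    then show ?thesis using assms(2)[OF True] by linarith
  next
    case False
    have "\<bar>G j\<bar> / R ^ j \<le> (\<Sum>i<J. \<bar>G i\<bar> / R ^ i)"
      using False \<open>0 < R\<close> by (intro member_le_sum) auto
    then have "\<bar>G j\<bar> / R ^ j \<le> B'" by (simp add: B'_def)
    then show ?thesis using \<open>0 < R\<close> by (simp add: pos_divide_le_eq)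
  qed
  then show ?thesis using \<open>0 < R\<close> unfolding geometrically_bounded_def by blast
qed

text \<open>Take \<open>x j\<close> where the \<open>j\<close>-th derivative has maximal modulus on
  a fixed compact interval. A geometric bound along these points would be a Cauchy-type bound on the
  whole interval and make the germ analytic.\<close>

lemma nonanalytic_germ_derivs:
  assumes sm: "smooth_on {- 1 / real k<..<1 / real k} f" and k: "1 \<le> k"
    and na: "germ0 f \<notin> germs0 real_analytic"
  obtains x where "\<And>j. \<bar>x j\<bar> \<le> 1 / (2 * real k)"
    "\<not> geometrically_bounded (\<lambda>j. norm (nth_deriv j f (x j)) / fact j)"
proof -
  define K where "K = {- (1 / (2 * real k))..1 / (2 * real k)}"
  have KU: "K \<subseteq> {- 1 / real k<..<1 / real k}"
  proof -
    have "1 / (2 * real k) < 1 / real k" using k by (simp add: field_simps)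
    then show ?thesis by (auto simp: K_def)
  qed
  have "\<exists>x\<in>K. \<forall>y\<in>K. norm (nth_deriv j f y) \<le> norm (nth_deriv j f x)" for j
  proof (rule continuous_attains_sup)
    show "compact K" "K \<noteq> {}" by (auto simp: K_def)
    show "continuous_on K (\<lambda>x. norm (nth_deriv j f x))"
      using KU sm unfolding smooth_on_def
      by (intro continuous_on_norm continuous_at_imp_continuous_on)
         (auto intro!: differentiable_imp_continuous_within)
  qed
  then obtain x where x: "\<And>j. x j \<in> K" "\<And>j y. y \<in> K \<Longrightarrow> norm (nth_deriv j f y) \<le> norm (nth_deriv j f (x j))"
    by metis
  have "\<not> geometrically_bounded (\<lambda>j. norm (nth_deriv j f (x j)) / fact j)"
  proof
    assume "geometrically_bounded (\<lambda>j. norm (nth_deriv j f (x j)) / fact j)"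
    then obtain B R where R: "R > 0" and B: "\<And>j. norm (nth_deriv j f (x j)) / fact j \<le> B * R ^ j"
      unfolding geometrically_bounded_def by blast
    have "germ0 f \<in> germs0 real_analytic"
    proof (rule real_analytic_germ[OF sm k _ R])
      fix n t assume "\<bar>t\<bar> \<le> 1 / (2 * real k)"
      then have "norm (nth_deriv n f t) \<le> norm (nth_deriv n f (x n))"
        by (intro x) (auto simp: K_def)
      also have "\<dots> \<le> B * R ^ n * fact n" using B[of n] by (simp add: pos_divide_le_eq)
      finally show "norm (nth_deriv n f t) \<le> B * R ^ n * fact n" .
    qed
    with na show False ..
  qed
  moreover have "\<bar>x j\<bar> \<le> 1 / (2 * real k)" for j using x(1)[of j] by (auto simp: K_def)
  ultimately show ?thesis using that by blast
qed

text \<open>Bang's bound is applied on \<open>{0..a}\<close> to the real parts of the derivatives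
  times \<open>d\<close>. The weight rescaled by \<open>D * h ^ n\<close> majorises them and remains
  log-convex and quasianalytic.\<close>

lemma borel_fun_geometric_bound:
  assumes wm: "weight_matrix \<M>" and qm: "quasianalytic_matrix \<M>"
    and f: "f \<in> E_roumieu \<M> {- 1 / real k<..<1 / real k}" and k: "1 \<le> k"
    and nonneg: "\<And>j. J \<le> j \<Longrightarrow> 0 \<le> Re (fps_nth (borel_fun f) j * d)"
  shows "geometrically_bounded (\<lambda>j. Re (fps_nth (borel_fun f) j * d))"
proof -
  define a where "a = 1 / (2 * real k)"
  have a: "a > 0" "{0..a} \<subseteq> {- 1 / real k<..<1 / real k}"
  proof -
    show "a > 0" using k by (simp add: a_def)
    have "a < 1 / real k" "- 1 / real k < 0" using k by (simp_all add: a_def field_simps)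
    then show "{0..a} \<subseteq> {- 1 / real k<..<1 / real k}" by auto
  qed
  have sm: "smooth_on {- 1 / real k<..<1 / real k} f" using f by (simp add: E_roumieu_def)
  obtain \<mu> h where \<mu>: "\<mu> > 0" and h: "h > 0" and db: "derivs_bounded {0..a} h (\<M> \<mu>) f"
    using f a(2) compact_Icc[of 0 a] unfolding E_roumieu_def by blast
  have ws: "weight_sequence (\<M> \<mu>)" using wm \<mu> by (simp add: weight_matrix_def)
  then have pos: "\<M> \<mu> n > 0" for n by (simp add: weight_sequence_def)
  have "\<exists>C. \<forall>j. \<forall>x\<in>{0..a}. norm (nth_deriv j f x) / (h ^ j * \<M> \<mu> j) \<le> C"
    using db unfolding derivs_bounded_def bdd_above_def by (auto simp del: atLeastAtMost_iff)
  then obtain C where C: "\<And>j x. x \<in> {0..a} \<Longrightarrow> norm (nth_deriv j f x) / (h ^ j * \<M> \<mu> j) \<le> C"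
    by blast
  \<comment> \<open>The added ones keep \<open>D\<close> positive even if \<open>C\<close> or
    \<open>d\<close> is zero.\<close>
  define D where "D = (\<bar>C\<bar> + 1) * (norm d + 1)"
  define M where "M n = D * h ^ n * \<M> \<mu> n" for n
  define g where "g n x = Re (nth_deriv n f x * d)" for n x
  have D: "D > 0" by (simp add: D_def add_nonneg_pos)
  have coeff: "Re (fps_nth (borel_fun f) j * d) = g j 0 / fact j" for j
  proof -
    have "fps_nth (borel_fun f) j * d = (nth_deriv j f 0 * d) / of_real (fact j)"
      by (simp add: borel_fun_def)
    then show ?thesis unfolding g_def by (simp only: Re_divide_of_real)
  qed
  have "g j 0 / fact j \<le> M J * a ^ J * (1 / a) ^ j" if "J \<le> j" for j
  proof (rule bang_geometric_bound[where g = g and M = M])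
    show "M n > 0" for n using D h pos by (simp add: M_def)
    show "(M n)\<^sup>2 \<le> M (n - 1) * M (n + 1)" if n: "1 \<le> n" for n
    proof -
      obtain m where m: "n = Suc m" using n by (cases n) auto
      have "(M n)\<^sup>2 = (D * h ^ n)\<^sup>2 * (\<M> \<mu> n)\<^sup>2" by (simp add: M_def power_mult_distrib)
      also have "\<dots> \<le> (D * h ^ n)\<^sup>2 * (\<M> \<mu> (n - 1) * \<M> \<mu> (n + 1))"
        using ws n by (intro mult_left_mono) (auto simp: weight_sequence_def)
      also have "\<dots> = M (n - 1) * M (n + 1)" by (simp add: M_def m power2_eq_square)
      finally show ?thesis .
    qed
    \<comment> \<open>Rescaling divides each quotient of consecutive weights by \<open>h\<close>, so
      the sum still diverges.\<close>
    have "filterlim (\<lambda>n. (1 / h) * (\<Sum>j=1..n. \<M> \<mu> (j - 1) / \<M> \<mu> j)) at_top sequentially"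
      using qm \<mu> h
      by (intro filterlim_tendsto_pos_mult_at_top[OF tendsto_const])
         (auto simp: quasianalytic_matrix_def quasianalytic_def)
    moreover have "(1 / h) * (\<Sum>j=1..n. \<M> \<mu> (j - 1) / \<M> \<mu> j) = (\<Sum>j=1..n. M (j - 1) / M j)" for n
      unfolding sum_distrib_left
    proof (rule sum.cong)
      fix j assume "j \<in> {1..n}"
      then obtain m where "j = Suc m" by (cases j) auto
      then show "1 / h * (\<M> \<mu> (j - 1) / \<M> \<mu> j) = M (j - 1) / M j"
        using D h by (simp add: M_def)
    qed simp
    ultimately show "quasianalytic M" by (simp add: quasianalytic_def)
    show "(g n has_real_derivative g (Suc n) x) (at x)" if "x \<in> {0..a}" for n x
      unfolding g_def using smooth_on_Re_nth_deriv[OF sm] a(2) that by blast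
    show "\<bar>g n x\<bar> \<le> M n" if "x \<in> {0..a}" for n x
    proof -
      have "\<bar>g n x\<bar> \<le> norm (nth_deriv n f x) * norm d"
        using abs_Re_le_cmod[of "nth_deriv n f x * d"] by (simp add: g_def norm_mult)
      also have "\<dots> \<le> ((\<bar>C\<bar> + 1) * (h ^ n * \<M> \<mu> n)) * (norm d + 1)"
      proof (intro mult_mono)
        have "norm (nth_deriv n f x) \<le> C * (h ^ n * \<M> \<mu> n)"
          using C[OF that, of n] h pos[of n] by (simp add: pos_divide_le_eq)
        also have "\<dots> \<le> (\<bar>C\<bar> + 1) * (h ^ n * \<M> \<mu> n)"
          using h pos[of n] by (intro mult_right_mono) auto
        finally show "norm (nth_deriv n f x) \<le> (\<bar>C\<bar> + 1) * (h ^ n * \<M> \<mu> n)" .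
        show "0 \<le> (\<bar>C\<bar> + 1) * (h ^ n * \<M> \<mu> n)" using h pos[of n] by simp
      qed auto
      also have "\<dots> = M n" by (simp add: M_def D_def)
      finally show ?thesis .
    qed
    show "0 \<le> g n 0" if "J \<le> n" for n
      using mult_nonneg_nonneg[OF nonneg[OF that], of "fact n"] unfolding coeff by simp
  qed (use a that in auto)
  then show ?thesis
    using a(1) unfolding coeff by (intro geometrically_boundedI[of "1 / a" J _ "M J * a ^ J"]) simp_all
qed

section \<open>Algebras spanned by real powers of a sequence\<close>

text \<open>Since \<open>0 powr \<gamma> = 0\<close> for every \<open>\<gamma>\<close>, zero entries
  of \<open>F\<close> stay zero in all powers.\<close>

definition pow_fps :: "(nat \<Rightarrow> real) \<Rightarrow> real \<Rightarrow> complex fps" where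
  "pow_fps F \<gamma> = Abs_fps (\<lambda>j. of_real (F j powr \<gamma>))"

definition pow_span :: "(nat \<Rightarrow> real) \<Rightarrow> real set \<Rightarrow> complex fps set" where
  "pow_span F X = {(\<Sum>\<gamma>\<in>I. fps_const (c \<gamma>) * pow_fps F \<gamma>) | I c. finite I \<and> I \<subseteq> X}"

lemma pow_fps_nth [simp]: "fps_nth (pow_fps F \<gamma>) j = of_real (F j powr \<gamma>)"
  by (simp add: pow_fps_def)

lemma pow_spanI:
  "finite I \<Longrightarrow> I \<subseteq> X \<Longrightarrow> (\<Sum>\<gamma>\<in>I. fps_const (c \<gamma>) * pow_fps F \<gamma>) \<in> pow_span F X"
  by (auto simp: pow_span_def)

lemma pow_spanE:
  assumes "H \<in> pow_span F X"
  obtains I c where "finite I" "I \<subseteq> X" "H = (\<Sum>\<gamma>\<in>I. fps_const (c \<gamma>) * pow_fps F \<gamma>)"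
  using assms by (auto simp: pow_span_def)

lemma pow_fps_hadamard: "pow_fps F \<gamma> \<odot> pow_fps F \<delta> = pow_fps F (\<gamma> + \<delta>)"
  by (simp add: hadamard_def fps_eq_iff powr_add)

lemma pow_span_base: "\<gamma> \<in> X \<Longrightarrow> pow_fps F \<gamma> \<in> pow_span F X"
  using pow_spanI[of "{\<gamma>}" X "\<lambda>_. 1" F] by simp

lemma pow_span_0: "0 \<in> pow_span F X"
  using pow_spanI[of "{}" X "\<lambda>_. 1" F] by simp

lemma pow_span_add:
  assumes "G \<in> pow_span F X" "H \<in> pow_span F X"
  shows "G + H \<in> pow_span F X"
proof -
  obtain I c where I: "finite I" "I \<subseteq> X" "G = (\<Sum>\<gamma>\<in>I. fps_const (c \<gamma>) * pow_fps F \<gamma>)"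
    using assms(1) by (rule pow_spanE)
  obtain J d where J: "finite J" "J \<subseteq> X" "H = (\<Sum>\<gamma>\<in>J. fps_const (d \<gamma>) * pow_fps F \<gamma>)"
    using assms(2) by (rule pow_spanE)
  define c' where "c' \<gamma> = (if \<gamma> \<in> I then c \<gamma> else 0)" for \<gamma>
  define d' where "d' \<gamma> = (if \<gamma> \<in> J then d \<gamma> else 0)" for \<gamma>
  have "G = (\<Sum>\<gamma>\<in>I \<union> J. fps_const (c' \<gamma>) * pow_fps F \<gamma>)"
    unfolding I(3) using I(1) J(1) by (intro sum.mono_neutral_cong_left) (auto simp: c'_def)
  moreover have "H = (\<Sum>\<gamma>\<in>I \<union> J. fps_const (d' \<gamma>) * pow_fps F \<gamma>)"
    unfolding J(3) using I(1) J(1) by (intro sum.mono_neutral_cong_left) (auto simp: d'_def)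
  ultimately have "G + H = (\<Sum>\<gamma>\<in>I \<union> J. fps_const (c' \<gamma> + d' \<gamma>) * pow_fps F \<gamma>)"
    by (simp add: sum.distrib distrib_right flip: fps_const_add)
  then show ?thesis using I J pow_spanI[of "I \<union> J" X "\<lambda>\<gamma>. c' \<gamma> + d' \<gamma>" F] by simp
qed

lemma pow_span_scale:
  assumes "H \<in> pow_span F X"
  shows "fps_const k * H \<in> pow_span F X"
proof -
  obtain I c where I: "finite I" "I \<subseteq> X" "H = (\<Sum>\<gamma>\<in>I. fps_const (c \<gamma>) * pow_fps F \<gamma>)"
    using assms by (rule pow_spanE)
  have "fps_const k * H = (\<Sum>\<gamma>\<in>I. fps_const (k * c \<gamma>) * pow_fps F \<gamma>)"
    unfolding I(3) sum_distrib_left by (simp add: mult.assoc flip: fps_const_mult)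
  then show ?thesis using pow_spanI[OF I(1,2)] by simp
qed

lemma pow_span_sum:
  "finite I \<Longrightarrow> (\<And>i. i \<in> I \<Longrightarrow> G i \<in> pow_span F X) \<Longrightarrow> sum G I \<in> pow_span F X"
  by (induction rule: finite_induct) (auto intro: pow_span_0 pow_span_add)

text \<open>Products of powers add exponents, so closure of \<open>X\<close> under addition is what
  the product requires.\<close>

lemma hadamard_subalgebra_pow_span:
  assumes "\<And>\<gamma> \<delta>. \<gamma> \<in> X \<Longrightarrow> \<delta> \<in> X \<Longrightarrow> \<gamma> + \<delta> \<in> X"
  shows "hadamard_subalgebra (pow_span F X)"
  unfolding hadamard_subalgebra_def
proof (intro conjI ballI allI)
  fix G H assume "G \<in> pow_span F X" "H \<in> pow_span F X"
  then obtain I c J d where I: "finite I" "I \<subseteq> X" "G = (\<Sum>\<gamma>\<in>I. fps_const (c \<gamma>) * pow_fps F \<gamma>)"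
    and J: "finite J" "J \<subseteq> X" "H = (\<Sum>\<gamma>\<in>J. fps_const (d \<gamma>) * pow_fps F \<gamma>)"
    by (elim pow_spanE)
  have "G \<odot> H = (\<Sum>\<gamma>\<in>I. \<Sum>\<delta>\<in>J. fps_const (c \<gamma> * d \<delta>) * pow_fps F (\<gamma> + \<delta>))"
    by (simp add: fps_eq_iff hadamard_def I(3) J(3) fps_sum_nth sum_product powr_add mult_ac)
  also have "\<dots> \<in> pow_span F X"
    using I J assms by (intro pow_span_sum pow_span_scale pow_span_base) auto
  finally show "G \<odot> H \<in> pow_span F X" .
qed (auto intro: pow_span_0 pow_span_add pow_span_scale)

text \<open>Relative to the term with the largest exponent \<open>\<beta>\<close>, the others carry
  \<open>y powr (\<gamma> - \<beta>)\<close> and together amount to at most half of it once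
  \<open>y\<close> is large. Nonzero entries do become large with \<open>j\<close>, being at least
  \<open>2 ^ j\<close>; at zero entries both sides vanish.\<close>

lemma dominant_power:
  fixes F :: "nat \<Rightarrow> real" and c :: "real \<Rightarrow> complex"
  assumes F: "\<And>j. F j = 0 \<or> 2 ^ j \<le> F j"
    and I: "finite I" "I \<noteq> {}" "I \<subseteq> {1..}" and c: "\<And>\<gamma>. \<gamma> \<in> I \<Longrightarrow> c \<gamma> \<noteq> 0"
  obtains d J where "\<And>j. J \<le> j \<Longrightarrow> F j / 2 \<le> Re ((\<Sum>\<gamma>\<in>I. c \<gamma> * of_real (F j powr \<gamma>)) * d)"
proof -
  define \<beta> where "\<beta> = Max I"
  have \<beta>: "\<beta> \<in> I" "\<And>\<gamma>. \<gamma> \<in> I \<Longrightarrow> \<gamma> \<le> \<beta>" using I by (auto simp: \<beta>_def)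
  then have \<beta>1: "1 \<le> \<beta>" using I by auto
  \<comment> \<open>Normalises the leading coefficient to 1, making the leading term real and
    nonnegative.\<close>
  define d where "d = 1 / c \<beta>"
  have "((\<lambda>y. \<Sum>\<gamma>\<in>I - {\<beta>}. norm (c \<gamma> * d) * y powr (\<gamma> - \<beta>)) \<longlongrightarrow> (\<Sum>\<gamma>\<in>I - {\<beta>}. 0)) at_top"
  proof (intro tendsto_sum tendsto_mult_right_zero tendsto_neg_powr filterlim_ident)
    fix \<gamma> assume "\<gamma> \<in> I - {\<beta>}"
    then show "\<gamma> - \<beta> < 0" using \<beta>(2)[of \<gamma>] by auto
  qed
  then have "\<forall>\<^sub>F y in at_top. (\<Sum>\<gamma>\<in>I - {\<beta>}. norm (c \<gamma> * d) * y powr (\<gamma> - \<beta>)) < 1 / 2"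
    by (rule order_tendstoD) simp
  then obtain Y where Y: "\<And>y. Y \<le> y \<Longrightarrow> (\<Sum>\<gamma>\<in>I - {\<beta>}. norm (c \<gamma> * d) * y powr (\<gamma> - \<beta>)) < 1 / 2"
    unfolding eventually_at_top_linorder by blast
  \<comment> \<open>Beyond \<open>J\<close> every nonzero entry exceeds the threshold
    \<open>Y\<close>.\<close>
  obtain J where J: "Y < 2 ^ J" using real_arch_pow[of 2 Y] by auto
  have "F j / 2 \<le> Re ((\<Sum>\<gamma>\<in>I. c \<gamma> * of_real (F j powr \<gamma>)) * d)" if j: "J \<le> j" for j
  proof (cases "F j = 0")
    case False
    define y where "y = F j"
    have "2 ^ j \<le> y" using F[of j] False by (simp add: y_def)
    moreover have "(2::real) ^ J \<le> 2 ^ j" using j by (intro power_increasing) auto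
    moreover have "(1::real) \<le> 2 ^ j" by simp
    ultimately have y: "Y \<le> y" "1 \<le> y" using J by linarith+
    define S where "S = (\<Sum>\<gamma>\<in>I - {\<beta>}. c \<gamma> * of_real (y powr \<gamma>)) * d"
    have "norm S \<le> (\<Sum>\<gamma>\<in>I - {\<beta>}. norm (c \<gamma> * d) * y powr \<gamma>)"
      unfolding S_def sum_distrib_right
      by (rule sum_norm_le) (simp add: norm_mult)
    also have "\<dots> = y powr \<beta> * (\<Sum>\<gamma>\<in>I - {\<beta>}. norm (c \<gamma> * d) * y powr (\<gamma> - \<beta>))"
      unfolding sum_distrib_left using y by (intro sum.cong) (auto simp: powr_diff)
    also have "\<dots> \<le> y powr \<beta> * (1 / 2)"
      using Y[OF y(1)] by (intro mult_left_mono) auto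
    finally have S: "norm S \<le> y powr \<beta> / 2" by simp
    have "(\<Sum>\<gamma>\<in>I. c \<gamma> * of_real (y powr \<gamma>)) * d = of_real (y powr \<beta>) + S"
      using c[OF \<beta>(1)] by (simp add: S_def sum.remove[OF I(1) \<beta>(1)] d_def distrib_right add_divide_distrib)
    then have "Re ((\<Sum>\<gamma>\<in>I. c \<gamma> * of_real (y powr \<gamma>)) * d) = y powr \<beta> + Re S"
      by simp
    moreover have "- Re S \<le> norm S" using abs_Re_le_cmod[of S] by linarith
    moreover have "y \<le> y powr \<beta>" using powr_mono[OF \<beta>1 y(2)] y by simp
    ultimately show ?thesis using S by (simp add: y_def)
  qed simp
  then show ?thesis using that by blast
qed

lemma pow_span_dominant:
  assumes F: "\<And>j. F j = 0 \<or> 2 ^ j \<le> F j" and X: "X \<subseteq> {1..}"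
    and H: "H \<in> pow_span F X" "H \<noteq> 0"
  obtains d J where "\<And>j. J \<le> j \<Longrightarrow> F j / 2 \<le> Re (fps_nth H j * d)"
proof -
  obtain I c where I: "finite I" "I \<subseteq> X" "H = (\<Sum>\<gamma>\<in>I. fps_const (c \<gamma>) * pow_fps F \<gamma>)"
    using H(1) by (rule pow_spanE)
  \<comment> \<open>Without zero coefficients the largest index carries the leading term;
    \<open>H \<noteq> 0\<close> keeps the set nonempty.\<close>
  define I' where "I' = {\<gamma>\<in>I. c \<gamma> \<noteq> 0}"
  have "H = (\<Sum>\<gamma>\<in>I'. fps_const (c \<gamma>) * pow_fps F \<gamma>)"
    unfolding I(3) using I(1) by (intro sum.mono_neutral_right) (auto simp: I'_def)
  then have nth: "fps_nth H j = (\<Sum>\<gamma>\<in>I'. c \<gamma> * of_real (F j powr \<gamma>))" for j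
    by (simp add: fps_sum_nth)
  have "I' \<noteq> {}" using nth H(2) by (auto simp: fps_eq_iff)
  with I X have I': "finite I'" "I' \<noteq> {}" "I' \<subseteq> {1..}" "\<And>\<gamma>. \<gamma> \<in> I' \<Longrightarrow> c \<gamma> \<noteq> 0"
    by (auto simp: I'_def)
  show ?thesis
  proof (rule dominant_power[OF F I'])
    fix d J assume "\<And>j. J \<le> j \<Longrightarrow> F j / 2 \<le> Re ((\<Sum>\<gamma>\<in>I'. c \<gamma> * of_real (F j powr \<gamma>)) * d)"
    then show ?thesis by (intro that[of J d]) (simp only: nth)
  qed
qed

text \<open>Otherwise a combination of powers with nonzero coefficients would vanish identically,
  and dominance would force \<open>F j \<le> 0\<close> from some index on.\<close>

lemma pow_fps_notin_pow_span:
  assumes F: "\<And>j. F j = 0 \<or> 2 ^ j \<le> F j" and ngb: "\<not> geometrically_bounded F"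
    and X: "X \<subseteq> {1..}" and \<alpha>: "1 \<le> \<alpha>" "\<alpha> \<notin> X"
  shows "pow_fps F \<alpha> \<notin> pow_span F X"
proof
  assume "pow_fps F \<alpha> \<in> pow_span F X"
  then obtain I c where I: "finite I" "I \<subseteq> X" "pow_fps F \<alpha> = (\<Sum>\<gamma>\<in>I. fps_const (c \<gamma>) * pow_fps F \<gamma>)"
    by (rule pow_spanE)
  define I' where "I' = {\<gamma>\<in>I. c \<gamma> \<noteq> 0}"
  \<comment> \<open>The coefficient \<open>- 1\<close> moves the power \<open>\<alpha>\<close> to
    the other side of the identity.\<close>
  define c' where "c' = c(\<alpha> := - 1)"
  have \<alpha>I': "\<alpha> \<notin> I'" "finite I'" using I \<alpha> by (auto simp: I'_def)
  have "pow_fps F \<alpha> = (\<Sum>\<gamma>\<in>I'. fps_const (c \<gamma>) * pow_fps F \<gamma>)"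
    unfolding I(3) using I(1) by (intro sum.mono_neutral_right) (auto simp: I'_def)
  then have "fps_nth (pow_fps F \<alpha>) j = fps_nth (\<Sum>\<gamma>\<in>I'. fps_const (c \<gamma>) * pow_fps F \<gamma>) j" for j
    by (rule arg_cong)
  then have "of_real (F j powr \<alpha>) = (\<Sum>\<gamma>\<in>I'. c \<gamma> * of_real (F j powr \<gamma>))" for j
    by (simp add: fps_sum_nth)
  moreover have "(\<Sum>\<gamma>\<in>I'. c' \<gamma> * of_real (F j powr \<gamma>)) = (\<Sum>\<gamma>\<in>I'. c \<gamma> * of_real (F j powr \<gamma>))" for j
    using \<alpha>I' by (intro sum.cong) (auto simp: c'_def)
  ultimately have zero: "(\<Sum>\<gamma>\<in>insert \<alpha> I'. c' \<gamma> * of_real (F j powr \<gamma>)) = 0" for j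
    using \<alpha>I' by (simp add: c'_def)
  obtain d J where "\<And>j. J \<le> j \<Longrightarrow> F j / 2 \<le> Re ((\<Sum>\<gamma>\<in>insert \<alpha> I'. c' \<gamma> * of_real (F j powr \<gamma>)) * d)"
    by (rule dominant_power[OF F, of "insert \<alpha> I'" c'])
       (use I X \<alpha> in \<open>auto simp: I'_def c'_def\<close>)
  then have "F j \<le> 0 * 1 ^ j" if "J \<le> j" for j using that by (simp only: zero) auto
  then have "geometrically_bounded F" by (intro geometrically_boundedI[of 1 J]) auto
  with ngb show False ..
qed

section \<open>A criterion for algebrability of complements of Borel images\<close>

lemma hadamard_subalgebra_hull: "hadamard_subalgebra (hadamard_subalgebra hull S)"
  by (rule hull_in) (auto simp: hadamard_subalgebra_def)

text \<open>Solidity as for sequence spaces: it admits truncations, moduli and powers of a member as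
  soon as some member dominates them.\<close>

definition solid :: "complex fps set \<Rightarrow> bool" where
  "solid A \<longleftrightarrow> (\<forall>G\<in>A. \<forall>H. (\<forall>j. norm (fps_nth H j) \<le> norm (fps_nth G j)) \<longrightarrow> H \<in> A)"

text \<open>Isolates what the ambient algebra has to provide, so that the Roumieu and Beurling cases
  are treated alike.\<close>

lemma algebrable_in_complement_borel_image:
  assumes wm: "weight_matrix \<M>" and qm: "quasianalytic_matrix \<M>"
    and A: "hadamard_subalgebra A" "solid A"
    and G: "G \<in> A" "\<not> geometrically_bounded (\<lambda>j. norm (fps_nth G j))"
  shows "algebrable_in A continuum (A - borel_map ` germs0 (E_roumieu \<M>))"
proof -
  \<comment> \<open>The cut-off at \<open>2 ^ j\<close> makes all nonzero entries large, as the
    dominance of the largest exponent requires.\<close>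
  define F where "F j = (if 2 ^ j \<le> norm (fps_nth G j) then norm (fps_nth G j) else 0)" for j
  have F: "F j = 0 \<or> 2 ^ j \<le> F j" for j by (simp add: F_def)
  have F0: "0 \<le> F j" for j by (simp add: F_def)
  have ngb: "\<not> geometrically_bounded F"
  proof
    assume "geometrically_bounded F"
    then obtain B R where R: "R > 0" "\<And>j. F j \<le> B * R ^ j"
      unfolding geometrically_bounded_def by blast
    \<comment> \<open>Discarded coefficients are below \<open>2 ^ j\<close>, so a geometric bound
      for \<open>F\<close> would carry over to \<open>G\<close>.\<close>
    have "norm (fps_nth G j) \<le> (\<bar>B\<bar> + 1) * max R 2 ^ j" for j
    proof -
      have "norm (fps_nth G j) \<le> F j + 2 ^ j" by (simp add: F_def)
      also have "\<dots> \<le> B * R ^ j + 2 ^ j" using R(2)[of j] by simp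
      also have "\<dots> \<le> \<bar>B\<bar> * max R 2 ^ j + max R 2 ^ j"
        using R(1) by (intro add_mono mult_mono power_mono) auto
      finally show ?thesis by (simp add: distrib_right)
    qed
    then show False using G(2) by (auto intro!: geometrically_boundedI[of "max R 2" 0])
  qed
  have E1: "pow_fps F 1 \<in> A"
  proof -
    have "norm (fps_nth (pow_fps F 1) j) \<le> norm (fps_nth G j)" for j
      using F0[of j] by (simp add: F_def)
    then show ?thesis using A(2) G(1) by (auto simp: solid_def)
  qed
  have EA: "pow_fps F \<alpha> \<in> A" if \<alpha>: "\<alpha> \<in> {1<..<2}" for \<alpha>
  proof -
    \<comment> \<open>The square dominates the intermediate powers, each entry being 0 or at least
      1.\<close>
    have "pow_fps F 2 \<in> A"
      using pow_fps_hadamard[of F 1 1] A(1) E1 by (metis hadamard_subalgebra_def one_add_one)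
    moreover have "norm (fps_nth (pow_fps F \<alpha>) j) \<le> norm (fps_nth (pow_fps F 2) j)" for j
    proof (cases "F j = 0")
      case False
      then have "2 ^ j \<le> F j" using F[of j] by simp
      then have "1 \<le> F j" using one_le_power[of "2::real" j] by linarith
      then have "F j powr \<alpha> \<le> F j powr 2" using \<alpha> by (intro powr_mono) auto
      then show ?thesis by simp
    qed simp
    ultimately show ?thesis using A(2) unfolding solid_def by blast
  qed
  define S where "S = pow_fps F ` {1<..<2}"
  define C where "C = hadamard_subalgebra hull S"
  have "C \<subseteq> A" unfolding C_def using EA A(1) by (intro hull_minimal) (auto simp: S_def)
  have "C \<subseteq> pow_span F {1..}" unfolding C_def
    by (intro hull_minimal hadamard_subalgebra_pow_span) (auto simp: S_def intro: pow_span_base)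
  have "inj_on (pow_fps F) {1<..<2}"
  proof (rule inj_onI, rule ccontr)
    fix \<alpha> \<beta> :: real assume *: "\<alpha> \<in> {1<..<2}" "\<beta> \<in> {1<..<2}" "pow_fps F \<alpha> = pow_fps F \<beta>" "\<alpha> \<noteq> \<beta>"
    \<comment> \<open>Independence from the span of a single power separates distinct
      exponents.\<close>
    have "pow_fps F \<alpha> \<notin> pow_span F {\<beta>}"
      using * by (intro pow_fps_notin_pow_span F ngb) auto
    then show False using *(3) pow_span_base[of \<beta> "{\<beta>}" F] by simp
  qed
  then have "{1<..<2::real} \<approx> S"
    unfolding S_def eqpoll_def using bij_betw_imageI by blast
  then have "S \<approx> (UNIV :: real set)"
    using open_interval_eqpoll_reals[of 1 2] eqpoll_sym eqpoll_trans by fastforce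
  then have card: "(card_of S, continuum) \<in> ordIso" by (simp add: eqpoll_iff_card_of_ordIso)
  have "hadamard_subalgebra hull T \<noteq> C" if T: "T \<subset> S" for T
  proof
    assume eq: "hadamard_subalgebra hull T = C"
    obtain \<alpha> where \<alpha>: "\<alpha> \<in> {1<..<2}" "pow_fps F \<alpha> \<notin> T" using T unfolding S_def by blast
    \<comment> \<open>Sums of two exponents exceed \<open>2\<close>, so no product of generators has an exponent in \<open>(1,2)\<close>.\<close>
    have "hadamard_subalgebra hull T \<subseteq> pow_span F ({1<..} - {\<alpha>})"
    proof (intro hull_minimal hadamard_subalgebra_pow_span)
      show "T \<subseteq> pow_span F ({1<..} - {\<alpha>})"
        using T \<alpha> by (auto simp: S_def intro!: pow_span_base)
    qed (use \<alpha> in auto)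
    moreover have "pow_fps F \<alpha> \<in> C" using \<alpha> by (auto simp: C_def S_def intro!: hull_inc)
    moreover have "pow_fps F \<alpha> \<notin> pow_span F ({1<..} - {\<alpha>})"
      using \<alpha> by (intro pow_fps_notin_pow_span F ngb) auto
    ultimately show False using eq by blast
  qed
  then have gen: "generated_by_card C continuum"
    unfolding generated_by_card_def minimal_generators_def using card C_def by blast
  have "H \<notin> borel_map ` germs0 (E_roumieu \<M>)" if H: "H \<in> C" "H \<noteq> 0" for H
  proof
    assume "H \<in> borel_map ` germs0 (E_roumieu \<M>)"
    then obtain k f where k: "1 \<le> k" and f: "f \<in> E_roumieu \<M> {- 1 / real k<..<1 / real k}"
      and Hf: "H = borel_fun f"
      by (auto simp: germs0_def borel_map_germ0)
    \<comment> \<open>The same \<open>d\<close> serves twice: it makes the real parts eventually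
      nonnegative, as Bang's bound requires, and lets them dominate \<open>F j / 2\<close>.\<close>
    obtain d J where dJ: "\<And>j. J \<le> j \<Longrightarrow> F j / 2 \<le> Re (fps_nth H j * d)"
      using pow_span_dominant[OF F order_refl _ H(2)] H(1) \<open>C \<subseteq> pow_span F {1..}\<close> by blast
    have "0 \<le> Re (fps_nth (borel_fun f) j * d)" if "J \<le> j" for j
      using dJ[OF that] F0[of j] Hf by simp
    then have "geometrically_bounded (\<lambda>j. Re (fps_nth H j * d))"
      unfolding Hf by (rule borel_fun_geometric_bound[OF wm qm f k])
    then obtain B R where R: "R > 0" "\<And>j. Re (fps_nth H j * d) \<le> B * R ^ j"
      unfolding geometrically_bounded_def by blast
    have "F j \<le> (2 * B) * R ^ j" if "J \<le> j" for j
      using dJ[OF that] R(2)[of j] by simp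
    then show False using ngb R(1) geometrically_boundedI by blast
  qed
  then show ?thesis
    unfolding algebrable_in_def using gen \<open>C \<subseteq> A\<close>
    by (intro conjI exI[of _ C]) (auto simp: C_def hadamard_subalgebra_hull)
qed

section \<open>Application to the Roumieu and Beurling spaces\<close>

lemma coeffs_bounded_solid:
  assumes "coeffs_bounded h M G" "\<And>j. 0 < M j" "0 < h"
    and "\<And>j. norm (fps_nth H j) \<le> norm (fps_nth G j)"
  shows "coeffs_bounded h M H"
proof -
  obtain B where B: "\<And>j. norm (fps_nth G j) / (h ^ j * (M j / fact j)) \<le> B"
    using assms(1) by (auto simp: coeffs_bounded_def bdd_above_def)
  have "norm (fps_nth H j) / (h ^ j * (M j / fact j)) \<le> B" for j
  proof -
    have "norm (fps_nth H j) / (h ^ j * (M j / fact j)) \<le> norm (fps_nth G j) / (h ^ j * (M j / fact j))"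
      using assms(2)[of j] assms(3,4) by (intro divide_right_mono) auto
    then show ?thesis using B[of j] by linarith
  qed
  then show ?thesis by (auto simp: coeffs_bounded_def bdd_above_def)
qed

lemma solid_F:
  assumes "weight_matrix \<N>"
  shows "solid (F_roumieu \<N>)" "solid (F_beurling \<N>)"
proof -
  have pos: "\<mu> > 0 \<Longrightarrow> 0 < \<N> \<mu> j" for \<mu> j
    using assms by (simp add: weight_matrix_def weight_sequence_def)
  show "solid (F_roumieu \<N>)"
    unfolding solid_def F_roumieu_def using coeffs_bounded_solid pos by blast
  show "solid (F_beurling \<N>)"
    unfolding solid_def F_beurling_def using coeffs_bounded_solid pos by blast
qed

lemma coeffs_bounded_derivs:
  assumes "derivs_bounded K h M f" "\<And>j. x j \<in> K"
  shows "coeffs_bounded h M (Abs_fps (\<lambda>j. nth_deriv j f (x j) / fact j))"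
proof -
  obtain B where B: "\<forall>j. \<forall>y\<in>K. norm (nth_deriv j f y) / (h ^ j * M j) \<le> B"
    using assms(1) by (auto simp: derivs_bounded_def bdd_above_def)
  show ?thesis
    unfolding coeffs_bounded_def bdd_above_def
    using B assms(2) by (intro exI[of _ B]) (auto simp: norm_divide)
qed

text \<open>Abstract \<open>\<E>\<close> and \<open>A\<close> serve both cases. The series collects
  derivatives at varying points and need not be the Taylor series of \<open>f\<close>; only the
  growth of its coefficients matters.\<close>

lemma nonanalytic_germ_in_F:
  assumes "germs0 real_analytic \<subset> germs0 \<E>"
    and sm: "\<And>U f. f \<in> \<E> U \<Longrightarrow> smooth_on U f"
    and bd: "\<And>U f K x. \<lbrakk>f \<in> \<E> U; compact K; K \<subseteq> U; \<And>j. x j \<in> K\<rbrakk>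
      \<Longrightarrow> Abs_fps (\<lambda>j. nth_deriv j f (x j) / fact j) \<in> A"
  obtains G where "G \<in> A" "\<not> geometrically_bounded (\<lambda>j. norm (fps_nth G j))"
proof -
  obtain g where g: "g \<in> germs0 \<E>" "g \<notin> germs0 real_analytic" using assms(1) by blast
  obtain k f where k: "1 \<le> k" and f: "f \<in> \<E> {- 1 / real k<..<1 / real k}" and "g = germ0 f"
    using g(1) by (auto simp: germs0_def)
  then have na: "germ0 f \<notin> germs0 real_analytic" using g(2) by simp
  obtain x where x: "\<And>j. \<bar>x j\<bar> \<le> 1 / (2 * real k)"
    and ngb: "\<not> geometrically_bounded (\<lambda>j. norm (nth_deriv j f (x j)) / fact j)"
    using nonanalytic_germ_derivs[OF sm[OF f] k na] by blast
  have "1 / (2 * real k) < 1 / real k" using k by (simp add: field_simps)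
  then have "{- (1 / (2 * real k))..1 / (2 * real k)} \<subseteq> {- 1 / real k<..<1 / real k}" by auto
  then have "Abs_fps (\<lambda>j. nth_deriv j f (x j) / fact j) \<in> A"
    using x by (intro bd[OF f, of "{- (1 / (2 * real k))..1 / (2 * real k)}"]) (auto simp: abs_le_iff minus_le_iff)
  then show ?thesis using ngb that by (auto simp: norm_divide)
qed

lemma E_beurling_subset_roumieu: "E_beurling \<M> U \<subseteq> E_roumieu \<M> U"
  unfolding E_beurling_def E_roumieu_def using zero_less_one by blast

lemma algebrable_in_antimono:
  "algebrable_in A \<kappa> (A - B) \<Longrightarrow> B' \<subseteq> B \<Longrightarrow> algebrable_in A \<kappa> (A - B')"
  unfolding algebrable_in_def by blast

theorem theorem4p9:
  fixes \<M> \<N> :: "real \<Rightarrow> nat \<Rightarrow> real"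
  assumes "weight_matrix \<M>" and "quasianalytic_matrix \<M>"
    and "weight_matrix \<N>" and "quasianalytic_matrix \<N>"
  shows "(growth_roumieu \<N> \<and> germs0 real_analytic \<subset> germs0 (E_roumieu \<N>) \<longrightarrow>
            algebrable_in (F_roumieu \<N>) continuum
              (F_roumieu \<N> - borel_map ` germs0 (E_roumieu \<M>)) \<and>
            algebrable_in (F_roumieu \<N>) continuum
              (F_roumieu \<N> - borel_map ` germs0 (E_beurling \<M>)))
       \<and> (growth_beurling \<N> \<and> germs0 real_analytic \<subset> germs0 (E_beurling \<N>) \<longrightarrow>
            algebrable_in (F_beurling \<N>) continuum
              (F_beurling \<N> - borel_map ` germs0 (E_roumieu \<M>)) \<and>
            algebrable_in (F_beurling \<N>) continuum
              (F_beurling \<N> - borel_map ` germs0 (E_beurling \<M>)))"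
proof -
  \<comment> \<open>A smaller image leaves a larger complement, so the claims for
    \<open>E_beurling \<M>\<close> follow from those for \<open>E_roumieu \<M>\<close>.\<close>
  have sub: "borel_map ` germs0 (E_beurling \<M>) \<subseteq> borel_map ` germs0 (E_roumieu \<M>)"
    using E_beurling_subset_roumieu unfolding germs0_def by blast
  have "algebrable_in (F_roumieu \<N>) continuum (F_roumieu \<N> - borel_map ` germs0 (E_roumieu \<M>))"
    if gr: "growth_roumieu \<N>" and na: "germs0 real_analytic \<subset> germs0 (E_roumieu \<N>)"
  proof -
    obtain G where "G \<in> F_roumieu \<N>" "\<not> geometrically_bounded (\<lambda>j. norm (fps_nth G j))"
    proof (rule nonanalytic_germ_in_F[OF na])
      fix U f K and x :: "nat \<Rightarrow> real"
      assume "f \<in> E_roumieu \<N> U" "compact K" "K \<subseteq> U" and x: "\<And>j. x j \<in> K"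
      then obtain \<mu> h where "0 < \<mu>" "0 < h" and db: "derivs_bounded K h (\<N> \<mu>) f"
        unfolding E_roumieu_def by blast
      then show "Abs_fps (\<lambda>j. nth_deriv j f (x j) / fact j) \<in> F_roumieu \<N>"
        unfolding F_roumieu_def mem_Collect_eq
        by (intro exI[of _ \<mu>] exI[of _ h] conjI coeffs_bounded_derivs[OF db x])
    qed (auto simp: E_roumieu_def)
    then show ?thesis
      using assms gr by (intro algebrable_in_complement_borel_image hadamard_subalgebra_F_roumieu solid_F)
  qed
  moreover have "algebrable_in (F_beurling \<N>) continuum (F_beurling \<N> - borel_map ` germs0 (E_roumieu \<M>))"
    if gr: "growth_beurling \<N>" and na: "germs0 real_analytic \<subset> germs0 (E_beurling \<N>)"
  proof -
    obtain G where "G \<in> F_beurling \<N>" "\<not> geometrically_bounded (\<lambda>j. norm (fps_nth G j))"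
    proof (rule nonanalytic_germ_in_F[OF na])
      fix U f K and x :: "nat \<Rightarrow> real"
      assume "f \<in> E_beurling \<N> U" "compact K" "K \<subseteq> U" and x: "\<And>j. x j \<in> K"
      then have db: "derivs_bounded K h (\<N> \<mu>) f" if "0 < \<mu>" "0 < h" for \<mu> h
        using that by (simp add: E_beurling_def)
      show "Abs_fps (\<lambda>j. nth_deriv j f (x j) / fact j) \<in> F_beurling \<N>"
        unfolding F_beurling_def mem_Collect_eq by (intro allI impI coeffs_bounded_derivs[OF db x])
    qed (auto simp: E_beurling_def)
    then show ?thesis
      using assms gr by (intro algebrable_in_complement_borel_image hadamard_subalgebra_F_beurling solid_F)
  qed
  ultimately show ?thesis using algebrable_in_antimono[OF _ sub] by blast
qed

end
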